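(* Let $X$ be an infinite dimensional uniformly smooth Banach space. Then there exist a sequence $(x_i)_{i=1}^\infty\subset X$ and a constant $\lambda>0$ such that $\|x_i-x_j\|=\lambda$ for all $i\neq j$.
   Context: The modulus of smoothness of a Banach space $X$ with unit sphere $S_X$ is $\rho_X(\tau)=\sup\{\frac12\|x+\tau y\|+\frac12\|x-\tau y\|-1 : x,y\in S_X\}$ for $\tau\in[0,\infty)$. The space $X$ is uniformly smooth if and only if $\lim_{\tau\to0^+}\rho_X(\tau)/\tau=0$. *)

theory Defs
  imports "HOL-Analysis.Analysis"
begin

text \<open>The space is the whole carrier type, hence the \<open>itself\<close> argument. For \<open>\<tau> \<ge> 0\<close> the set below is
  bounded above by \<open>\<tau>\<close>, and it is nonempty unless the space is trivial, so the real-valued supremum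
  is the intended one.\<close>

definition modulus_of_smoothness :: "'a::real_normed_vector itself \<Rightarrow> real \<Rightarrow> real" where
  "modulus_of_smoothness X \<tau> =
     Sup {norm (x + \<tau> *\<^sub>R y) / 2 + norm (x - \<tau> *\<^sub>R y) / 2 - 1 | x y :: 'a.
            x \<in> sphere 0 1 \<and> y \<in> sphere 0 1}"

definition uniformly_smooth :: "'a::real_normed_vector itself \<Rightarrow> bool" where
  "uniformly_smooth X \<longleftrightarrow> ((\<lambda>\<tau>. modulus_of_smoothness X \<tau> / \<tau>) \<longlongrightarrow> 0) (at_right 0)"

definition infinite_dimensional :: "'a::real_vector itself \<Rightarrow> bool" where
  "infinite_dimensional X \<longleftrightarrow> \<not> (\<exists>B :: 'a set. finite B \<and> span B = UNIV)"

end

theory Submission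
  imports Defs
begin

text \<open>
  The sequence is built one point at a time, every new point being a small correction of a vector
  far out in a weakly null direction. Limits along an ultrafilter take the place of passing to
  subsequences.

  The ultrafilter. Finitely many linear functionals on an infinite-dimensional space have a common
  zero on the unit sphere, so there is an ultrafilter \<open>U\<close> on the unit sphere in which every bounded
  linear functional is eventually equal to \<open>0\<close> (\<open>weakly_null_ultrafilter_exists\<close>). Every bounded real
  function has a limit along \<open>U\<close>. Put \<open>\<tau> v = lim\<^sub>x \<parallel>v - x\<parallel>\<close> and \<open>lam = lim\<^sub>x \<tau> x\<close>. The function \<open>\<tau>\<close>
  is convex, and it inherits from the norm a derivative \<open>\<tau>' v\<close> with uniform error bounds wherever
  \<open>\<tau>\<close> is bounded away from \<open>0\<close>. Let also \<open>\<gamma> = lim\<^sub>x \<tau>' x\<close>, a bounded linear functional.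

  One step. Suppose \<open>y\<^sub>0, \<dots>, y\<^sub>n\<^sub>-\<^sub>1\<close> have mutual distance \<open>lam\<close>, satisfy \<open>\<tau> y\<^sub>i = lam\<close>, and admit
  vectors \<open>v\<^sub>j\<close> with \<open>\<tau>' y\<^sub>i v\<^sub>j = \<delta>\<^sub>i\<^sub>j\<close> and \<open>\<gamma> v\<^sub>j = 0\<close>. For \<open>x\<close> generic with respect to \<open>U\<close> the
  \<open>n + 1\<close> equations \<open>\<parallel>y\<^sub>i - (x + h)\<parallel> = lam\<close> and \<open>\<tau> (x + h) = lam\<close> are almost solved by \<open>h = 0\<close>. On
  the \<open>v\<^sub>j\<close> their derivatives are close to \<open>-\<delta>\<^sub>i\<^sub>j\<close> and to \<open>0\<close>, the latter because \<open>\<gamma> v\<^sub>j = 0\<close>.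
  Hence the vectors \<open>-v\<^sub>j\<close> and a suitable combination of \<open>x\<close> with the \<open>v\<^sub>j\<close> are nearly
  biorthogonal to the derivatives, provided \<open>\<tau>' x x\<close> stays away from \<open>0\<close>, and a contraction argument
  gives an exact small solution (\<open>near_biorthogonal_system_solvable\<close>). Since \<open>\<tau>' y\<^sub>i x = 0\<close> and
  \<open>\<gamma> x = 0\<close> hold exactly, a Gram-Schmidt step with \<open>x\<close> restores the dual vectors
  (\<open>extend_configuration\<close>).

  The gap. By convexity \<open>\<tau>' x x \<ge> \<tau> x - \<tau> 0\<close>, so everything works as soon as \<open>\<tau> 0 < lam\<close>. For
  the ultrafilter on the sphere \<open>\<tau> 0 = 1\<close>. If \<open>lam \<le> 1\<close>, then typical pairs satisfy \<open>\<parallel>x - y\<parallel> \<approx> 1\<close>,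
  and \<open>\<parallel>x + y\<parallel> \<approx> 1\<close> as well would produce an almost isometric copy of the two-dimensional sup norm,
  which is not smooth (\<open>iterated_sum_exceeds_one\<close>). So \<open>\<parallel>x + y\<parallel> \<ge> 1 + \<eta>\<close>. Replace \<open>U\<close> by the law of
  \<open>x - y\<close>: its elements have norm about \<open>1\<close>, and the difference \<open>(x\<^sub>1 - x\<^sub>2) - (x\<^sub>3 - x\<^sub>4)\<close> of two of
  them has norm at least about \<open>\<parallel>x\<^sub>2 + x\<^sub>3\<parallel>\<close>, because adding a weakly null vector does not decrease
  norms in the limit (\<open>difference_filter_has_gap\<close>).
\<close>

section \<open>Ultrafilters and limits along them\<close>

definition ultrafilter :: "'a filter \<Rightarrow> bool" where
  "ultrafilter U \<longleftrightarrow> U \<noteq> bot \<and> (\<forall>P. eventually P U \<or> eventually (\<lambda>x. \<not> P x) U)"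

lemma ultrafilter_nonbot [simp]: "ultrafilter U \<Longrightarrow> U \<noteq> bot"
  by (simp add: ultrafilter_def)

lemma ultrafilter_dichotomy:
  "ultrafilter U \<Longrightarrow> eventually P U \<or> eventually (\<lambda>x. \<not> P x) U"
  by (simp add: ultrafilter_def)

text \<open>Zorn's lemma for the proper filters below \<open>F\<close>: the infimum of a chain of proper filters is
  proper, because what is eventually true in it is already so in one member of the chain.\<close>

lemma ultrafilter_refinement_exists:
  fixes F :: "'a filter"
  assumes "F \<noteq> bot"
  shows "\<exists>U. ultrafilter U \<and> U \<le> F"
proof -
  define A where "A = {G. G \<noteq> bot \<and> G \<le> F}"
  have "\<exists>m\<in>A. \<forall>a\<in>A. a \<le> m \<longrightarrow> a = m"
  proof (rule predicate_Zorn)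
    show "partial_order_on A (relation_of (\<lambda>x y. y \<le> x) A)"
      by (auto simp: partial_order_on_def preorder_on_def refl_on_def trans_def antisym_def relation_of_def)
  next
    fix C assume C: "C \<in> Chains (relation_of (\<lambda>x y. y \<le> x) A)"
    have chain: "G \<in> A" "G \<le> H \<or> H \<le> G" if "G \<in> C" "H \<in> C" for G H
      using C that by (auto simp: Chains_def relation_of_def)
    show "\<exists>u\<in>A. \<forall>a\<in>C. u \<le> a"
    proof (cases "C = {}")
      case True
      then show ?thesis using assms by (auto simp: A_def)
    next
      case False
      have "eventually P (Inf C) \<longleftrightarrow> (\<exists>b\<in>C. eventually P b)" for P
      proof (rule eventually_Inf_base[OF False])
        fix G H assume "G \<in> C" "H \<in> C"
        then show "\<exists>x\<in>C. x \<le> inf G H"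
          using chain(2)[of G H] by (metis inf.absorb1 inf.absorb2 order_refl)
      qed
      then have "Inf C \<noteq> bot"
        using chain(1) by (auto simp: trivial_limit_def A_def)
      moreover obtain G where "G \<in> C" using False by blast
      then have "Inf C \<le> F"
        using chain(1)[of G G] by (auto simp: A_def intro: Inf_lower2)
      ultimately show ?thesis by (auto simp: A_def intro: Inf_lower)
    qed
  qed
  then obtain U where U: "U \<noteq> bot" "U \<le> F" and max: "\<And>G. G \<noteq> bot \<Longrightarrow> G \<le> U \<Longrightarrow> G = U"
    by (force simp: A_def)
  \<comment> \<open>Adding \<open>P\<close> to \<open>U\<close> gives an improper filter or, by minimality of \<open>U\<close>, nothing new.\<close>
  have "eventually P U \<or> eventually (\<lambda>x. \<not> P x) U" for P
  proof (cases "inf U (principal (Collect P)) = bot")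
    case True
    then have "eventually (\<lambda>x. \<not> P x) U"
      by (simp add: trivial_limit_def eventually_inf_principal)
    then show ?thesis ..
  next
    case False
    then have "inf U (principal (Collect P)) = U" by (intro max) auto
    then have "U \<le> principal (Collect P)" by (simp add: inf.absorb_iff1)
    then show ?thesis by (simp add: le_principal)
  qed
  with U show ?thesis by (auto simp: ultrafilter_def)
qed

text \<open>The limit is the supremum of the numbers that are eventually below \<open>f\<close>: a larger number \<open>b\<close> is
  not eventually below \<open>f\<close>, so by the dichotomy \<open>f < b\<close> eventually.\<close>

lemma ultrafilter_tendsto_Lim:
  fixes f :: "'a \<Rightarrow> real"
  assumes U: "ultrafilter U" and bdd: "\<forall>\<^sub>F x in U. \<bar>f x\<bar> \<le> B"
  shows "(f \<longlongrightarrow> Lim U f) U"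
proof -
  define S where "S = {c. \<forall>\<^sub>F x in U. c \<le> f x}"
  have nb: "U \<noteq> bot" using U by simp
  have ub: "c \<le> B" if "c \<in> S" for c
  proof -
    have "\<forall>\<^sub>F x in U. c \<le> B"
      using that[unfolded S_def mem_Collect_eq] bdd by eventually_elim linarith
    then show ?thesis using nb by (simp add: eventually_const_iff)
  qed
  have bdd_S: "bdd_above S" using ub by (auto simp: bdd_above_def)
  have "- B \<in> S" unfolding S_def mem_Collect_eq using bdd by eventually_elim linarith
  then have ne: "S \<noteq> {}" by blast
  have "(f \<longlongrightarrow> Sup S) U"
  proof (rule order_tendstoI)
    fix a assume "a < Sup S"
    then obtain c where c: "c \<in> S" "a < c" using less_cSup_iff[OF ne bdd_S] by blast
    then have "\<forall>\<^sub>F x in U. c \<le> f x" by (simp add: S_def)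
    then show "\<forall>\<^sub>F x in U. a < f x" by eventually_elim (use c in linarith)
  next
    fix a assume a: "Sup S < a"
    then obtain b where b: "Sup S < b" "b < a" using dense by blast
    then have "b \<notin> S" using cSup_upper[OF _ bdd_S] by force
    then have "\<forall>\<^sub>F x in U. \<not> b \<le> f x"
      using ultrafilter_dichotomy[OF U, of "\<lambda>x. b \<le> f x"] by (auto simp: S_def)
    then show "\<forall>\<^sub>F x in U. f x < a" by eventually_elim (use b in linarith)
  qed
  moreover from this have "Lim U f = Sup S" using tendsto_Lim[OF nb] by blast
  ultimately show ?thesis by simp
qed

lemma ultrafilter_Lim_bounded:
  fixes f :: "'a \<Rightarrow> real"
  assumes U: "ultrafilter U" and bdd: "\<forall>\<^sub>F x in U. \<bar>f x\<bar> \<le> B"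
  shows "\<bar>Lim U f\<bar> \<le> B"
proof (rule tendsto_upperbound)
  show "((\<lambda>x. \<bar>f x\<bar>) \<longlongrightarrow> \<bar>Lim U f\<bar>) U"
    by (intro tendsto_intros ultrafilter_tendsto_Lim[OF U bdd])
qed (use assms in auto)

lemma bounded_linear_Lim:
  fixes D :: "'i \<Rightarrow> 'a::real_normed_vector \<Rightarrow> real"
  assumes U: "ultrafilter U" and lin: "\<And>x. bounded_linear (D x)" and le: "\<And>x h. \<bar>D x h\<bar> \<le> norm h"
  shows "bounded_linear (\<lambda>h. Lim U (\<lambda>x. D x h))"
proof -
  have lim: "((\<lambda>x. D x h) \<longlongrightarrow> Lim U (\<lambda>x. D x h)) U" for h
    by (rule ultrafilter_tendsto_Lim[OF U, of _ "norm h"]) (simp add: le)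
  show ?thesis
  proof (rule bounded_linear_intro[where K = 1])
    fix h k
    have "((\<lambda>x. D x (h + k)) \<longlongrightarrow> Lim U (\<lambda>x. D x h) + Lim U (\<lambda>x. D x k)) U"
      unfolding linear_add[OF bounded_linear.linear[OF lin]] by (intro tendsto_intros lim)
    then show "Lim U (\<lambda>x. D x (h + k)) = Lim U (\<lambda>x. D x h) + Lim U (\<lambda>x. D x k)"
      using tendsto_Lim[OF ultrafilter_nonbot[OF U]] by blast
  next
    fix r h
    have "((\<lambda>x. D x (r *\<^sub>R h)) \<longlongrightarrow> r *\<^sub>R Lim U (\<lambda>x. D x h)) U"
      unfolding linear_scale[OF bounded_linear.linear[OF lin]] by (intro tendsto_intros lim)
    then show "Lim U (\<lambda>x. D x (r *\<^sub>R h)) = r *\<^sub>R Lim U (\<lambda>x. D x h)"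
      using tendsto_Lim[OF ultrafilter_nonbot[OF U]] by blast
  next
    fix h
    show "norm (Lim U (\<lambda>x. D x h)) \<le> norm h * 1"
      using ultrafilter_Lim_bounded[OF U, of "\<lambda>x. D x h" "norm h"] le by simp
  qed
qed

section \<open>A weakly null ultrafilter on the unit sphere\<close>

text \<open>Finitely many functionals see only a finite-dimensional part of the space. A new functional \<open>g\<close>
  either vanishes on the common kernel of the old ones, and then the old span suffices, or a vector
  \<open>k\<close> of that kernel with \<open>g k \<noteq> 0\<close> is added to adjust the value of \<open>g\<close>.\<close>

lemma finitely_many_values_attained_in_finite_span:
  fixes G :: "('a::real_vector \<Rightarrow> real) set"
  assumes "finite G" and "\<And>g. g \<in> G \<Longrightarrow> linear g"
  shows "\<exists>B. finite B \<and> (\<forall>x. \<exists>b\<in>span B. \<forall>g\<in>G. g x = g b)"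
  using assms
proof (induction G rule: finite_induct)
  case empty
  then show ?case by (auto intro: exI[of _ "{}"])
next
  case (insert g G)
  then obtain B where B: "finite B" "\<And>x. \<exists>b\<in>span B. \<forall>g\<in>G. g x = g b" by blast
  have lin: "linear g" "\<And>g'. g' \<in> G \<Longrightarrow> linear g'" using insert.prems by auto
  show ?case
  proof (cases "\<exists>k. (\<forall>g'\<in>G. g' k = 0) \<and> g k \<noteq> 0")
    case True
    then obtain k where k: "\<forall>g'\<in>G. g' k = 0" "g k \<noteq> 0" by blast
    have "\<exists>b\<in>span (insert k B). \<forall>g'\<in>insert g G. g' x = g' b" for x
    proof -
      obtain b where b: "b \<in> span B" "\<forall>g'\<in>G. g' x = g' b" using B(2) by blast
      let ?b = "b + ((g x - g b) / g k) *\<^sub>R k"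
      have "?b \<in> span (insert k B)"
        using b(1) span_mono[of B "insert k B"]
        by (intro span_add span_scale) (auto intro: span_base)
      moreover have "\<forall>g'\<in>insert g G. g' x = g' ?b"
        using b(2) k lin by (auto simp: linear_add linear_scale)
      ultimately show ?thesis by blast
    qed
    then show ?thesis using B(1) by (intro exI[of _ "insert k B"]) simp
  next
    case False
    have "\<exists>b\<in>span B. \<forall>g'\<in>insert g G. g' x = g' b" for x
    proof -
      obtain b where b: "b \<in> span B" "\<forall>g'\<in>G. g' x = g' b" using B(2) by blast
      then have "\<forall>g'\<in>G. g' (x - b) = 0" using lin(2) by (simp add: linear_diff)
      then have "g (x - b) = 0" using False by blast
      then show ?thesis using b lin(1) by (auto simp: linear_diff)
    qed
    then show ?thesis using B(1) by blast
  qed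
qed

lemma unit_vector_in_finite_intersection_of_kernels:
  fixes G :: "('a::real_normed_vector \<Rightarrow> real) set"
  assumes inf: "infinite_dimensional TYPE('a)" and fin: "finite G" and lin: "\<And>g. g \<in> G \<Longrightarrow> linear g"
  shows "\<exists>x. norm x = 1 \<and> (\<forall>g\<in>G. g x = 0)"
proof -
  obtain B where B: "finite B" "\<And>x. \<exists>b\<in>span B. \<forall>g\<in>G. g x = g b"
    using finitely_many_values_attained_in_finite_span[OF fin lin] by blast
  have "span B \<noteq> UNIV" using inf B(1) by (auto simp: infinite_dimensional_def)
  then obtain x where x: "x \<notin> span B" by blast
  obtain b where b: "b \<in> span B" "\<forall>g\<in>G. g x = g b" using B(2) by blast
  let ?z = "(x - b) /\<^sub>R norm (x - b)"
  have "x \<noteq> b" using x b(1) by blast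
  then have "norm ?z = 1" by simp
  moreover have "\<forall>g\<in>G. g ?z = 0" using b(2) lin by (simp add: linear_scale linear_diff)
  ultimately show ?thesis by blast
qed

text \<open>The unit vectors annihilated by \<open>g\<close>, for varying \<open>g\<close>, have the finite intersection property and
  hence generate a proper filter. Functionals thus vanish eventually instead of merely tending to
  \<open>0\<close>; this exactness is what later makes the correction of dual vectors a plain Gram-Schmidt step.\<close>

lemma weakly_null_ultrafilter_exists:
  assumes inf: "infinite_dimensional TYPE('a::real_normed_vector)"
  shows "\<exists>U :: 'a filter. ultrafilter U \<and> (\<forall>\<^sub>F x in U. norm x = 1)
           \<and> (\<forall>g::'a \<Rightarrow> real. bounded_linear g \<longrightarrow> (\<forall>\<^sub>F x in U. g x = 0))"
proof -
  define K where "K g = principal {x::'a. norm x = 1 \<and> g x = 0}" for g :: "'a \<Rightarrow> real"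
  define F where "F = (INF g\<in>{g. bounded_linear g}. K g)"
  have "F \<noteq> bot"
    unfolding F_def
  proof (rule INF_filter_not_bot)
    fix G :: "('a \<Rightarrow> real) set" assume G: "G \<subseteq> {g. bounded_linear g}" "finite G"
    then obtain x :: 'a where x: "norm x = 1" "\<forall>g\<in>G. g x = 0"
      using unit_vector_in_finite_intersection_of_kernels[OF inf, of G]
      by (auto dest: bounded_linear.linear)
    then have "principal {x} \<le> (INF g\<in>G. K g)"
      by (intro INF_greatest) (simp add: K_def)
    then show "(INF g\<in>G. K g) \<noteq> bot"
      by (metis bot.extremum_uniqueI insert_not_empty principal_eq_bot_iff)
  qed
  then obtain U where U: "ultrafilter U" "U \<le> F"
    using ultrafilter_refinement_exists by blast
  have *: "\<forall>\<^sub>F x in U. norm x = 1 \<and> g x = 0" if "bounded_linear g" for g :: "'a \<Rightarrow> real"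
  proof -
    have "U \<le> K g" using U(2) that unfolding F_def by (auto intro: order_trans INF_lower)
    then show ?thesis by (simp add: K_def le_principal)
  qed
  have "\<forall>\<^sub>F x in U. norm x = 1"
    using *[OF bounded_linear_zero] by simp
  moreover have "\<forall>\<^sub>F x in U. g x = 0" if "bounded_linear g" for g :: "'a \<Rightarrow> real"
    using *[OF that] by eventually_elim simp
  ultimately show ?thesis using U(1) by blast
qed

section \<open>First-order behaviour of a uniformly smooth norm\<close>

text \<open>By homogeneity the second difference at \<open>v\<close> is at most \<open>2 \<parallel>v\<parallel> \<rho>(\<parallel>h\<parallel> / \<parallel>v\<parallel>)\<close>, with \<open>\<rho>\<close> the modulus of
  smoothness; the lower bound \<open>c\<close> on \<open>\<parallel>v\<parallel>\<close> makes the ratio uniformly small.\<close>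

lemma uniformly_smooth_norm_second_difference:
  assumes smooth: "uniformly_smooth TYPE('a::real_normed_vector)" and "e > 0" "c > 0"
  shows "\<exists>d>0. \<forall>v h::'a. c \<le> norm v \<longrightarrow> norm h \<le> d \<longrightarrow>
           norm (v + h) + norm (v - h) - 2 * norm v \<le> e * norm h"
proof -
  have "\<forall>\<^sub>F t in at_right 0. \<bar>modulus_of_smoothness TYPE('a) t / t\<bar> < e / 2"
    using smooth \<open>e > 0\<close> unfolding uniformly_smooth_def tendsto_iff by (auto dest: spec[of _ "e/2"])
  then obtain d0 where d0: "d0 > 0"
    and mod: "\<And>t. 0 < t \<Longrightarrow> t < d0 \<Longrightarrow> \<bar>modulus_of_smoothness TYPE('a) t / t\<bar> < e / 2"
    by (auto simp: eventually_at_right_field)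
  let ?d = "c * d0 / 2"
  have "norm (v + h) + norm (v - h) - 2 * norm v \<le> e * norm h"
    if v: "c \<le> norm v" and h: "norm h \<le> ?d" for v h :: 'a
  proof (cases "h = 0")
    case False
    have v0: "norm v > 0" using v \<open>c > 0\<close> by linarith
    define t where "t = norm h / norm v"
    have t: "0 < t" "t < d0"
    proof -
      show "0 < t" using v0 False by (simp add: t_def)
      have "norm h \<le> norm v * d0 / 2"
        using h v d0 by (meson divide_right_mono mult_right_mono less_imp_le order_trans zero_le_numeral)
      also have "\<dots> < norm v * d0" using v0 d0 by simp
      finally show "t < d0" using v0 by (simp add: t_def divide_simps mult.commute)
    qed
    define x where "x = v /\<^sub>R norm v"
    define y where "y = h /\<^sub>R norm h"
    have xy: "x \<in> sphere 0 1" "y \<in> sphere 0 1" using v0 False by (auto simp: x_def y_def)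
    have vh: "v = norm v *\<^sub>R x" "h = norm v *\<^sub>R (t *\<^sub>R y)"
      using v0 False by (auto simp: x_def y_def t_def)
    let ?S = "{norm (x + t *\<^sub>R y) / 2 + norm (x - t *\<^sub>R y) / 2 - 1 | x y :: 'a.
                 x \<in> sphere 0 1 \<and> y \<in> sphere 0 1}"
    have "bdd_above ?S"
    proof (rule bdd_aboveI)
      fix s assume "s \<in> ?S"
      then obtain x y :: 'a where s: "s = norm (x + t *\<^sub>R y) / 2 + norm (x - t *\<^sub>R y) / 2 - 1"
        and "norm x = 1" "norm y = 1" by auto
      then have "norm (x + t *\<^sub>R y) \<le> 1 + t" "norm (x - t *\<^sub>R y) \<le> 1 + t"
        using norm_triangle_ineq[of x "t *\<^sub>R y"] norm_triangle_ineq4[of x "t *\<^sub>R y"] t(1) by auto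
      then show "s \<le> t" using s by simp
    qed
    then have "norm (x + t *\<^sub>R y) / 2 + norm (x - t *\<^sub>R y) / 2 - 1 \<le> modulus_of_smoothness TYPE('a) t"
      unfolding modulus_of_smoothness_def using xy by (intro cSup_upper) blast+
    also have "\<dots> \<le> e / 2 * t"
      using mod[OF t] t(1) by (simp add: divide_simps abs_less_iff split: if_splits)
    finally have le: "norm v * (norm (x + t *\<^sub>R y) + norm (x - t *\<^sub>R y) - 2) \<le> norm v * (e * t)"
      using v0 by (intro mult_left_mono) auto
    have "v + h = norm v *\<^sub>R (x + t *\<^sub>R y)" using vh by (metis scaleR_add_right)
    then have plus: "norm (v + h) = norm v * norm (x + t *\<^sub>R y)" using v0 by simp
    have "v - h = norm v *\<^sub>R (x - t *\<^sub>R y)" using vh by (metis scaleR_diff_right)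
    then have minus: "norm (v - h) = norm v * norm (x - t *\<^sub>R y)" using v0 by simp
    have "norm (v + h) + norm (v - h) - 2 * norm v
        = norm v * (norm (x + t *\<^sub>R y) + norm (x - t *\<^sub>R y) - 2)"
      unfolding plus minus by (simp add: algebra_simps)
    also note le
    also have "norm v * (e * t) = e * norm h" using v0 by (simp add: t_def)
    finally show ?thesis .
  qed simp
  moreover have "?d > 0" using \<open>c > 0\<close> d0 by simp
  ultimately show ?thesis by blast
qed

text \<open>For \<open>v \<noteq> 0\<close> the subgradient is the derivative of the norm. The difference quotients \<open>q t h\<close>
  increase with \<open>t\<close>, so their infimum \<open>p h\<close> is the one-sided directional derivative. It is sublinear by convexity, and smoothness forces \<open>p h + p (- h) \<le> 0\<close>; a sublinear
  odd function is linear.\<close>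

lemma smooth_norming_functional_exists:
  fixes v :: "'a::real_normed_vector"
  assumes smooth: "uniformly_smooth TYPE('a)"
  shows "\<exists>D. bounded_linear D \<and> (\<forall>h. norm v + D h \<le> norm (v + h))"
proof (cases "v = 0")
  case True
  then show ?thesis by (intro exI[of _ "\<lambda>_. 0"]) auto
next
  case False
  define q where "q t h = (norm (v + t *\<^sub>R h) - norm v) / t" for t and h :: 'a
  define p where "p h = (INF t\<in>{0<..}. q t h)" for h :: 'a
  have q_lower: "- norm h \<le> q t h" if "t > 0" for t h
  proof -
    have "norm v \<le> norm (v + t *\<^sub>R h) + t * norm h"
      using norm_triangle_ineq4[of "v + t *\<^sub>R h" "t *\<^sub>R h"] that by simp
    then show ?thesis using that by (simp add: q_def field_simps)
  qed
  have bdd: "bdd_below ((\<lambda>t. q t h) ` {0<..})" for h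
    using q_lower by (intro bdd_belowI[of _ "- norm h"]) auto
  have p_le: "p h \<le> q t h" if "t > 0" for t h
    unfolding p_def using bdd that by (intro cINF_lower) auto
  have p_ge: "c \<le> p h" if "\<And>t. t > 0 \<Longrightarrow> c \<le> q t h" for c h
    unfolding p_def using that by (intro cINF_greatest) auto
  have q_mono: "q s h \<le> q t h" if "0 < s" "s \<le> t" for s t h
  proof -
    have "v + s *\<^sub>R h = (1 - s/t) *\<^sub>R v + (s/t) *\<^sub>R (v + t *\<^sub>R h)"
      using that by (simp add: algebra_simps)
    then have "norm (v + s *\<^sub>R h) \<le> (1 - s/t) * norm v + (s/t) * norm (v + t *\<^sub>R h)"
      using that norm_triangle_ineq[of "(1 - s/t) *\<^sub>R v" "(s/t) *\<^sub>R (v + t *\<^sub>R h)"] by simp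
    then have "norm (v + s *\<^sub>R h) - norm v \<le> (s/t) * (norm (v + t *\<^sub>R h) - norm v)"
      by (simp add: algebra_simps)
    then show ?thesis using that by (simp add: q_def field_simps)
  qed
  have q_add: "q (t/2) (h + k) \<le> q t h + q t k" if "t > 0" for t h k
  proof -
    have "v + (t/2) *\<^sub>R (h + k) = (1/2) *\<^sub>R (v + t *\<^sub>R h) + (1/2) *\<^sub>R (v + t *\<^sub>R k)"
      by (simp add: algebra_simps flip: scaleR_add_left)
    then have "norm (v + (t/2) *\<^sub>R (h + k)) \<le> norm (v + t *\<^sub>R h) / 2 + norm (v + t *\<^sub>R k) / 2"
      using norm_triangle_ineq[of "(1/2) *\<^sub>R (v + t *\<^sub>R h)" "(1/2) *\<^sub>R (v + t *\<^sub>R k)"] by simp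
    then have "(2 * norm (v + (t/2) *\<^sub>R (h + k)) - 2 * norm v) / t
        \<le> (norm (v + t *\<^sub>R h) + norm (v + t *\<^sub>R k) - 2 * norm v) / t"
      using that by (intro divide_right_mono) auto
    then show ?thesis by (simp add: q_def diff_divide_distrib add_divide_distrib mult.commute)
  qed
  have p_add_le: "p (h + k) \<le> p h + p k" for h k
  proof -
    have *: "p (h + k) \<le> q s h + q t k" if "s > 0" "t > 0" for s t
      using p_le[of "min s t / 2" "h + k"] q_add[of "min s t" h k] that
        q_mono[of "min s t" s h] q_mono[of "min s t" t k] by auto
    have "p (h + k) - q s h \<le> p k" if "s > 0" for s
      using *[OF that] by (intro p_ge) (simp add: algebra_simps)
    then have "p (h + k) - p k \<le> p h" by (intro p_ge) (simp add: algebra_simps)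
    then show ?thesis by simp
  qed
  have p_scale_le: "p (c *\<^sub>R h) \<le> c * p h" if "c > 0" for c h
  proof -
    have "p (c *\<^sub>R h) / c \<le> q t h" if "t > 0" for t
      using p_le[of "t / c" "c *\<^sub>R h"] that \<open>c > 0\<close> by (simp add: q_def divide_simps mult_ac)
    then have "p (c *\<^sub>R h) / c \<le> p h" by (rule p_ge)
    then show ?thesis using that by (simp add: field_simps)
  qed
  have p_scale: "p (c *\<^sub>R h) = c * p h" if "c > 0" for c h
    using p_scale_le[OF that, of h] p_scale_le[of "1/c" "c *\<^sub>R h"] that by (simp add: field_simps)
  have p0: "p 0 = 0"
    unfolding p_def q_def by simp
  have p_sym_le: "p h + p (- h) \<le> 0" for h
  proof (rule field_le_epsilon)
    fix e :: real assume "e > 0"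
    obtain d where d: "d > 0" "\<And>k. norm k \<le> d \<Longrightarrow>
        norm (v + k) + norm (v - k) - 2 * norm v \<le> e / (norm h + 1) * norm k"
      using uniformly_smooth_norm_second_difference[OF smooth, of "e / (norm h + 1)" "norm v"]
        \<open>e > 0\<close> False by (auto simp: add_nonneg_pos)
    define t where "t = d / (norm h + 1)"
    have h1: "norm h + 1 > 0" by (simp add: add_nonneg_pos)
    have t: "t > 0" using d(1) h1 by (simp add: t_def)
    have "norm (t *\<^sub>R h) \<le> d" using d(1) h1 by (simp add: t_def field_simps)
    note d(2)[OF this]
    moreover have "q t h + q t (- h) = (norm (v + t *\<^sub>R h) + norm (v - t *\<^sub>R h) - 2 * norm v) / t"
      by (simp add: q_def diff_divide_distrib add_divide_distrib)
    ultimately have "q t h + q t (- h) \<le> (e / (norm h + 1) * norm (t *\<^sub>R h)) / t"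
      using t by (simp only: divide_right_mono less_imp_le)
    also have "\<dots> = e / (norm h + 1) * norm h" using t by simp
    also have "\<dots> \<le> e" using \<open>e > 0\<close> h1 by (simp add: field_simps)
    finally show "p h + p (- h) \<le> 0 + e" using p_le[OF t, of h] p_le[OF t, of "- h"] by simp
  qed
  have p_minus: "p (- h) = - p h" for h
    using p_sym_le[of h] p_add_le[of h "- h"] p0 by simp
  have "bounded_linear p"
  proof (rule bounded_linear_intro[where K = 1])
    show "p (h + k) = p h + p k" for h k
      using p_add_le[of h k] p_add_le[of "- h" "- k"] p_minus[of "h + k"] by (simp add: p_minus)
    show "p (c *\<^sub>R h) = c *\<^sub>R p h" for c h
      using p_scale[of c h] p_scale[of "- c" "h"] p_minus[of "c *\<^sub>R h"] p0
      by (cases c "0::real" rule: linorder_cases) auto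
    have p_upper: "p h \<le> norm h" for h
      using p_le[of 1 h] norm_triangle_ineq[of v h] by (simp add: q_def)
    show "norm (p h) \<le> norm h * 1" for h
      using p_upper[of h] p_upper[of "- h"] p_minus[of h] by (simp add: abs_le_iff)
  qed
  moreover have "norm v + p h \<le> norm (v + h)" for h
    using p_le[of 1 h] by (simp add: q_def)
  ultimately show ?thesis by blast
qed

text \<open>For \<open>v \<noteq> 0\<close> in a smooth space this is the derivative of the norm at \<open>v\<close>. At \<open>v = 0\<close> the choice is
  arbitrary, but the subgradient inequality holds there too, which spares case distinctions.\<close>

definition norming_functional :: "'a::real_normed_vector \<Rightarrow> 'a \<Rightarrow> real" where
  "norming_functional v = (SOME D. bounded_linear D \<and> (\<forall>h. norm v + D h \<le> norm (v + h)))"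

lemma
  fixes v :: "'a::real_normed_vector"
  assumes "uniformly_smooth TYPE('a)"
  shows bounded_linear_norming_functional: "bounded_linear (norming_functional v)"
    and norming_functional_subgradient: "norm v + norming_functional v h \<le> norm (v + h)"
  using someI_ex[OF smooth_norming_functional_exists[OF assms, of v]]
  unfolding norming_functional_def by blast+

text \<open>First-order bounds at a single point make a convex function strictly differentiable there: the
  slope from \<open>k\<close> to \<open>h\<close> is at most the slope over the continuation of that segment by the length
  \<open>d / 2\<close>, and over such a long segment the error \<open>e * d\<close> is only \<open>2 * e\<close> times the length.\<close>

lemma strict_derivative_of_convex:
  fixes F :: "'a::real_normed_vector \<Rightarrow> real"
  assumes convex: "convex_on UNIV F" and D: "linear D"
    and lower: "\<And>h. F 0 + D h \<le> F h"
    and upper: "\<And>h. norm h \<le> d \<Longrightarrow> F h \<le> F 0 + D h + e * norm h"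
    and "d > 0" "e > 0" and h: "norm h \<le> d / 2" and k: "norm k \<le> d / 2"
  shows "\<bar>F h - F k - D (h - k)\<bar> \<le> 2 * e * norm (h - k)"
proof -
  have one_sided: "F h - F k \<le> D (h - k) + 2 * e * norm (h - k)"
    if h: "norm h \<le> d / 2" and "h \<noteq> k" for h k
  proof -
    \<comment> \<open>The factor \<open>s\<close> makes the continuation \<open>s *\<^sub>R (h - k)\<close> exactly \<open>d / 2\<close> long, so \<open>z\<close> stays in the ball.\<close>
    define s where "s = d / 2 / norm (h - k)"
    define z where "z = h + s *\<^sub>R (h - k)"
    have s: "s > 0" using that \<open>d > 0\<close> by (simp add: s_def)
    have sn: "s * norm (h - k) = d / 2" using that by (simp add: s_def)
    have "norm z \<le> norm h + s * norm (h - k)"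
      unfolding z_def using norm_triangle_ineq[of h "s *\<^sub>R (h - k)"] s by simp
    then have z: "norm z \<le> d" using h sn by simp
    have "h = (1 - 1 / (1 + s)) *\<^sub>R k + (1 / (1 + s)) *\<^sub>R z"
    proof -
      have "(1 + s) *\<^sub>R ((1 - 1 / (1 + s)) *\<^sub>R k + (1 / (1 + s)) *\<^sub>R z) = (1 + s) *\<^sub>R h"
        using s by (simp add: z_def scaleR_add_right field_simps)
      then show ?thesis using s by simp
    qed
    moreover have "1 - 1 / (1 + s) = s / (1 + s)" using s by (simp add: field_simps)
    ultimately have "F h \<le> (s / (1 + s)) * F k + (1 / (1 + s)) * F z"
      using convex_onD[OF convex, of "1 / (1 + s)" k z] s by simp
    also have "\<dots> = (s * F k + F z) / (1 + s)"
      by (simp add: add_divide_distrib)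
    finally have "(1 + s) * F h \<le> s * F k + F z"
      using s by (simp add: pos_le_divide_eq mult.commute)
    then have "s * (F h - F k) \<le> F z - F h" by (simp add: algebra_simps)
    also have "\<dots> \<le> D z + e * d - D h"
    proof -
      have "e * norm z \<le> e * d" using z \<open>e > 0\<close> by simp
      then show ?thesis using upper[OF z] lower[of h] by linarith
    qed
    also have "\<dots> = s * (D (h - k) + 2 * e * norm (h - k))"
    proof -
      have "D z = D h + s * D (h - k)" by (simp add: z_def linear_add[OF D] linear_scale[OF D])
      then show ?thesis using sn by (simp add: algebra_simps)
    qed
    finally show ?thesis using s by simp
  qed
  show ?thesis
  proof (cases "h = k")
    case True
    then show ?thesis using linear_0[OF D] by simp
  next
    case False
    then show ?thesis
      using one_sided[of h k] one_sided[of k h] h k linear_diff[OF D, of h k] linear_diff[OF D, of k h]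
      by (auto simp: norm_minus_commute abs_le_iff)
  qed
qed

lemma convex_norm_minus:
  fixes w :: "'a::real_normed_vector"
  shows "convex_on UNIV (\<lambda>h. norm (w - h))"
proof (rule convex_onI)
  fix t :: real and x y :: 'a assume t: "0 < t" "t < 1"
  have "w - ((1 - t) *\<^sub>R x + t *\<^sub>R y) = (1 - t) *\<^sub>R (w - x) + t *\<^sub>R (w - y)"
    by (simp add: algebra_simps)
  then show "norm (w - ((1 - t) *\<^sub>R x + t *\<^sub>R y)) \<le> (1 - t) * norm (w - x) + t * norm (w - y)"
    using norm_triangle_ineq[of "(1 - t) *\<^sub>R (w - x)" "t *\<^sub>R (w - y)"] t by simp
qed simp

section \<open>Nonlinear systems with nearly biorthogonal derivative\<close>

text \<open>Picard iteration of \<open>c \<mapsto> c - \<Phi> c\<close>, a contraction with factor \<open>1/2\<close> in the maximum norm. The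
  coordinates are kept in functions on \<open>nat\<close>, cut off at \<open>n\<close>, because the number \<open>n\<close> of equations grows
  in the course of the construction.\<close>

lemma contraction_solves_perturbed_identity:
  fixes \<Phi> :: "(nat \<Rightarrow> real) \<Rightarrow> nat \<Rightarrow> real"
  assumes "\<kappa> > 0"
    and start: "\<And>i. i < n \<Longrightarrow> \<bar>\<Phi> (\<lambda>_. 0) i\<bar> \<le> \<kappa> / 2"
    and near_id: "\<And>c d m i. \<lbrakk>i < n; \<And>j. \<bar>c j\<bar> \<le> \<kappa>; \<And>j. \<bar>d j\<bar> \<le> \<kappa>; \<And>j. \<bar>c j - d j\<bar> \<le> m\<rbrakk>
                   \<Longrightarrow> \<bar>\<Phi> c i - \<Phi> d i - (c i - d i)\<bar> \<le> m / 2"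
  shows "\<exists>c. (\<forall>j. \<bar>c j\<bar> \<le> \<kappa>) \<and> (\<forall>i<n. \<Phi> c i = 0)"
proof -
  define N where "N c = (\<lambda>i. if i < n then c i - \<Phi> c i else 0)" for c :: "nat \<Rightarrow> real"
  have N_lip: "\<bar>N c i - N d i\<bar> \<le> m / 2"
    if "\<And>j. \<bar>c j\<bar> \<le> \<kappa>" "\<And>j. \<bar>d j\<bar> \<le> \<kappa>" "\<And>j. \<bar>c j - d j\<bar> \<le> m" for c d m i
  proof (cases "i < n")
    case True
    have "N c i - N d i = - (\<Phi> c i - \<Phi> d i - (c i - d i))" using True by (simp add: N_def)
    then show ?thesis using near_id[OF True that] by (simp only: abs_minus_cancel)
  next
    case False
    have "0 \<le> m" using that(3)[of 0] abs_ge_zero order_trans by blast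
    then show ?thesis using False by (simp add: N_def)
  qed
  have N_small: "\<bar>N c i\<bar> \<le> \<kappa>" if "\<And>j. \<bar>c j\<bar> \<le> \<kappa>" for c i
  proof -
    have "\<bar>N (\<lambda>_. 0) i\<bar> \<le> \<kappa> / 2" using start[of i] \<open>\<kappa> > 0\<close> by (auto simp: N_def)
    moreover have "\<bar>N c i - N (\<lambda>_. 0) i\<bar> \<le> \<kappa> / 2" using that \<open>\<kappa> > 0\<close> by (intro N_lip) auto
    ultimately show ?thesis by linarith
  qed
  define a where "a k = (N ^^ k) (\<lambda>_. 0)" for k
  have a_Suc: "a (Suc k) = N (a k)" for k by (simp add: a_def)
  have a_bound: "\<bar>a k i\<bar> \<le> \<kappa>" for k i
    using \<open>\<kappa> > 0\<close> by (induction k arbitrary: i) (simp_all add: a_Suc N_small, simp add: a_def)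
  have a_dist: "\<bar>a (k + m) i - a k i\<bar> \<le> \<kappa> / 2 ^ k" for k m i
  proof (induction k arbitrary: i)
    case 0
    then show ?case using a_bound[of m i] by (simp add: a_def)
  next
    case (Suc k)
    then show ?case
      using N_lip[of "a (k + m)" "a k" "\<kappa> / 2 ^ k" i] a_bound by (simp add: a_Suc)
  qed
  have small: "(\<lambda>k. \<kappa> / 2 ^ k) \<longlonglongrightarrow> 0"
    by (rule LIMSEQ_divide_realpow_zero) simp
  have "convergent (\<lambda>k. a k i)" for i
  proof (rule Cauchy_convergent, rule CauchyI')
    fix e :: real assume "e > 0"
    then obtain k where k: "\<kappa> / 2 ^ k < e / 2"
      using order_tendstoD(2)[OF small, of "e/2"] by (auto simp: eventually_sequentially)
    have "dist (a m i) (a n i) < e" if "m \<ge> k" "n > m" for m n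
    proof -
      have "\<bar>a m i - a k i\<bar> \<le> \<kappa> / 2 ^ k" "\<bar>a n i - a k i\<bar> \<le> \<kappa> / 2 ^ k"
        using a_dist[of k "m - k" i] a_dist[of k "n - k" i] that by simp_all
      then show ?thesis unfolding dist_real_def using k by linarith
    qed
    then show "\<exists>M. \<forall>m\<ge>M. \<forall>n>m. dist (a m i) (a n i) < e" by blast
  qed
  then obtain L where L: "(\<lambda>k. a k i) \<longlonglongrightarrow> L i" for i
    by (meson convergent_def)
  have L_dist: "\<bar>L i - a k i\<bar> \<le> \<kappa> / 2 ^ k" for i k
  proof (rule tendsto_upperbound)
    show "((\<lambda>m. \<bar>a (k + m) i - a k i\<bar>) \<longlongrightarrow> \<bar>L i - a k i\<bar>) sequentially"
      using LIMSEQ_ignore_initial_segment[OF L[of i], of k]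
      by (intro tendsto_intros) (simp add: add.commute)
  qed (use a_dist in auto)
  have L_bound: "\<bar>L i\<bar> \<le> \<kappa>" for i
    using L_dist[of i 0] by (simp add: a_def)
  have "N L i = L i" for i
  proof -
    \<comment> \<open>Both \<open>N L\<close> and \<open>L\<close> are within half of this bound of \<open>a (Suc k)\<close>.\<close>
    have "\<bar>N L i - L i\<bar> \<le> \<kappa> / 2 ^ k" for k
      using N_lip[of L "a k" "\<kappa> / 2 ^ k" i] L_bound a_bound L_dist L_dist[of i "Suc k"]
      by (simp add: a_Suc)
    then have "\<bar>N L i - L i\<bar> \<le> 0"
      by (intro tendsto_lowerbound[OF small]) auto
    then show ?thesis by simp
  qed
  then have "\<Phi> L i = 0" if "i < n" for i
    using that by (metis N_def add_cancel_right_right diff_eq_eq)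
  then show ?thesis using L_bound by blast
qed

text \<open>A Newton method with fixed derivative: in the coordinates \<open>c\<close> of \<open>h = (\<Sum>j<n. c j *\<^sub>R u j)\<close> the
  system \<open>F i h = l\<close> is a perturbation of the identity. Half of the admissible contraction factor is
  spent on the failure of biorthogonality, the other half on the failure of linearity.\<close>

lemma near_biorthogonal_system_solvable:
  fixes F L :: "nat \<Rightarrow> 'a::real_normed_vector \<Rightarrow> real" and u :: "nat \<Rightarrow> 'a" and n :: nat and C r l :: real
  assumes "n > 0" "C > 0" "r > 0"
    and lin: "\<And>i. i < n \<Longrightarrow> linear (L i)"
    and u: "\<And>j. j < n \<Longrightarrow> norm (u j) \<le> C"
    and biorth: "\<And>i j. i < n \<Longrightarrow> j < n \<Longrightarrow> \<bar>L i (u j) - (if i = j then 1 else 0)\<bar> \<le> 1 / (4 * real n)"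
    and deriv: "\<And>i h k. \<lbrakk>i < n; norm h \<le> r; norm k \<le> r\<rbrakk>
       \<Longrightarrow> \<bar>F i h - F i k - L i (h - k)\<bar> \<le> norm (h - k) / (4 * real n * C)"
    and start: "\<And>i. i < n \<Longrightarrow> \<bar>F i 0 - l\<bar> \<le> r / (2 * real n * C)"
  shows "\<exists>h. norm h \<le> r \<and> (\<forall>i<n. F i h = l)"
proof -
  define \<kappa> where "\<kappa> = r / (n * C)"
  define H where "H c = (\<Sum>j<n. c j *\<^sub>R u j)" for c :: "nat \<Rightarrow> real"
  have H_le: "norm (H c) \<le> n * C * m" if "\<And>j. \<bar>c j\<bar> \<le> m" for c m
  proof -
    have "norm (H c) \<le> (\<Sum>j<n. C * m)"
      unfolding H_def
    proof (rule sum_norm_le)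
      fix j assume "j \<in> {..<n}"
      then have "\<bar>c j\<bar> * norm (u j) \<le> m * C"
        using that[of j] u[of j] by (intro mult_mono) auto
      then show "norm (c j *\<^sub>R u j) \<le> C * m" by (simp add: mult.commute)
    qed
    then show ?thesis by simp
  qed
  have nC: "n * C > 0" using assms(1,2) by simp
  have H_ball: "norm (H c) \<le> r" if "\<And>j. \<bar>c j\<bar> \<le> \<kappa>" for c
    using H_le[of c \<kappa>] that assms(1,2) by (simp add: \<kappa>_def)
  have "\<exists>c. (\<forall>j. \<bar>c j\<bar> \<le> \<kappa>) \<and> (\<forall>i<n. F i (H c) - l = 0)"
  proof (rule contraction_solves_perturbed_identity)
    show "\<kappa> > 0" using nC \<open>r > 0\<close> by (simp add: \<kappa>_def)
    show "\<bar>F i (H (\<lambda>_. 0)) - l\<bar> \<le> \<kappa> / 2" if "i < n" for i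
      using start[OF that] by (simp add: H_def \<kappa>_def mult_ac)
  next
    fix c d :: "nat \<Rightarrow> real" and m i
    assume i: "i < n" and c: "\<And>j. \<bar>c j\<bar> \<le> \<kappa>" and d: "\<And>j. \<bar>d j\<bar> \<le> \<kappa>" and m: "\<And>j. \<bar>c j - d j\<bar> \<le> m"
    have Hc: "norm (H c) \<le> r" by (rule H_ball) (rule c)
    have Hd: "norm (H d) \<le> r" by (rule H_ball) (rule d)
    have diff: "H c - H d = H (\<lambda>j. c j - d j)"
      by (simp add: H_def sum_subtractf algebra_simps)
    have "norm (H c - H d) / (4 * real n * C) \<le> (n * C * m) / (4 * real n * C)"
      unfolding diff using H_le[of "\<lambda>j. c j - d j" m] m nC by (intro divide_right_mono) (auto simp: mult.commute)
    also have "\<dots> = m / 4" using assms(1,2) by simp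
    finally have 1: "\<bar>F i (H c) - F i (H d) - L i (H c - H d)\<bar> \<le> m / 4"
      using deriv[OF i, of "H c" "H d"] Hc Hd by linarith
    have "L i (H c - H d) = (\<Sum>j<n. (c j - d j) * L i (u j))"
      unfolding diff using lin[OF i] by (simp add: H_def linear_sum linear_scale)
    moreover have "c i - d i = (\<Sum>j<n. (c j - d j) * (if i = j then 1 else 0))"
      using i by (simp add: if_distrib cong: if_cong)
    ultimately have "L i (H c - H d) - (c i - d i)
        = (\<Sum>j<n. (c j - d j) * L i (u j)) - (\<Sum>j<n. (c j - d j) * (if i = j then 1 else 0))"
      by simp
    also have "\<dots> = (\<Sum>j<n. (c j - d j) * (L i (u j) - (if i = j then 1 else 0)))"
      by (simp add: sum_subtractf right_diff_distrib)
    also have "\<bar>\<dots>\<bar> \<le> (\<Sum>j<n. m * (1 / (4 * real n)))"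
    proof (rule order_trans[OF sum_abs sum_mono])
      fix j assume "j \<in> {..<n}"
      then show "\<bar>(c j - d j) * (L i (u j) - (if i = j then 1 else 0))\<bar> \<le> m * (1 / (4 * real n))"
        unfolding abs_mult using m[of j] biorth[OF i, of j] by (intro mult_mono) auto
    qed
    also have "\<dots> = m / 4" using \<open>n > 0\<close> by simp
    finally show "\<bar>F i (H c) - l - (F i (H d) - l) - (c i - d i)\<bar> \<le> m / 2"
      using 1 by linarith
  qed
  then show ?thesis using H_ball by auto
qed

section \<open>The limit norm of a weakly null ultrafilter\<close>

text \<open>Only boundedness is kept from the ultrafilter on the unit sphere, so that the law of a difference
  of two of its elements is again an instance.\<close>

locale weakly_null_ultrafilter =
  fixes U :: "'a::banach filter"
  assumes smooth: "uniformly_smooth TYPE('a)"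
    and ultra: "ultrafilter U"
    and bounded: "\<exists>R. \<forall>\<^sub>F x in U. norm x \<le> R"
    and null: "\<And>g :: 'a \<Rightarrow> real. bounded_linear g \<Longrightarrow> \<forall>\<^sub>F x in U. g x = 0"
begin

text \<open>The value \<open>\<tau> v\<close> is the distance from \<open>v\<close> to a generic point far out, and \<open>lam\<close> is the distance of
  two generic points; it becomes the distance of the equilateral set.\<close>

definition \<tau> :: "'a \<Rightarrow> real" where "\<tau> v = Lim U (\<lambda>x. norm (v - x))"
definition \<tau>' :: "'a \<Rightarrow> 'a \<Rightarrow> real" where "\<tau>' v h = Lim U (\<lambda>x. norming_functional (v - x) h)"
definition lam :: real where "lam = Lim U \<tau>"
definition \<gamma> :: "'a \<Rightarrow> real" where "\<gamma> h = Lim U (\<lambda>x. \<tau>' x h)"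

lemma nonbot [simp]: "U \<noteq> bot"
  using ultra by simp

lemma linear_norming_functional: "linear (norming_functional (w :: 'a))"
  using bounded_linear_norming_functional[OF smooth] by (rule bounded_linear.linear)

lemma norming_functional_le: "\<bar>norming_functional v h\<bar> \<le> norm (h::'a)"
proof -
  have *: "norming_functional v h \<le> norm h" for h
    using norming_functional_subgradient[OF smooth, of v h] norm_triangle_ineq[of v h] by linarith
  show ?thesis
    using *[of h] *[of "- h"] linear_neg[OF linear_norming_functional]
    by (simp add: abs_le_iff)
qed

lemma tendsto_\<tau>: "((\<lambda>x. norm (v - x)) \<longlongrightarrow> \<tau> v) U"
proof -
  obtain R where "\<forall>\<^sub>F x in U. norm x \<le> R" using bounded by blast
  then have "\<forall>\<^sub>F x in U. \<bar>norm (v - x)\<bar> \<le> norm v + R"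
  proof eventually_elim
    fix x :: 'a assume "norm x \<le> R"
    then show "\<bar>norm (v - x)\<bar> \<le> norm v + R" using norm_triangle_ineq4[of v x] by simp
  qed
  then show ?thesis unfolding \<tau>_def by (rule ultrafilter_tendsto_Lim[OF ultra])
qed

lemma tendsto_\<tau>': "((\<lambda>x. norming_functional (v - x) h) \<longlongrightarrow> \<tau>' v h) U"
  unfolding \<tau>'_def
  by (rule ultrafilter_tendsto_Lim[OF ultra, of _ "norm h"]) (simp add: norming_functional_le)

lemma bounded_linear_\<tau>': "bounded_linear (\<tau>' v)"
  unfolding \<tau>'_def
  by (intro bounded_linear_Lim ultra bounded_linear_norming_functional smooth norming_functional_le)

lemma \<tau>'_le: "\<bar>\<tau>' v h\<bar> \<le> norm h"
  unfolding \<tau>'_def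
  by (rule ultrafilter_Lim_bounded[OF ultra]) (simp add: norming_functional_le)

lemma tendsto_\<gamma>: "((\<lambda>x. \<tau>' x h) \<longlongrightarrow> \<gamma> h) U"
  unfolding \<gamma>_def by (rule ultrafilter_tendsto_Lim[OF ultra, of _ "norm h"]) (simp add: \<tau>'_le)

lemma bounded_linear_\<gamma>: "bounded_linear \<gamma>"
  unfolding \<gamma>_def by (intro bounded_linear_Lim ultra bounded_linear_\<tau>' \<tau>'_le)

lemma \<tau>_subgradient: "\<tau> v + \<tau>' v h \<le> \<tau> (v + h)"
proof (rule tendsto_le[OF nonbot])
  show "((\<lambda>x. norm (v + h - x)) \<longlongrightarrow> \<tau> (v + h)) U" by (rule tendsto_\<tau>)
  show "((\<lambda>x. norm (v - x) + norming_functional (v - x) h) \<longlongrightarrow> \<tau> v + \<tau>' v h) U"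
    by (intro tendsto_intros tendsto_\<tau> tendsto_\<tau>')
  show "\<forall>\<^sub>F x in U. norm (v - x) + norming_functional (v - x) h \<le> norm (v + h - x)"
    using norming_functional_subgradient[OF smooth, of "v - x" h for x] by (simp add: algebra_simps)
qed

lemma \<tau>_add_le: "\<tau> (v + h) \<le> \<tau> v + norm h"
  using \<tau>_subgradient[of "v + h" "- h"] \<tau>'_le[of "v + h" "- h"] by simp

lemma \<tau>_nonneg: "0 \<le> \<tau> v"
  by (rule tendsto_lowerbound[OF tendsto_\<tau>]) auto

lemma tendsto_lam: "(\<tau> \<longlongrightarrow> lam) U"
proof -
  obtain R where "\<forall>\<^sub>F x in U. norm x \<le> R" using bounded by blast
  then have "\<forall>\<^sub>F x in U. \<bar>\<tau> x\<bar> \<le> \<tau> 0 + R"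
  proof eventually_elim
    fix x :: 'a assume "norm x \<le> R"
    then show "\<bar>\<tau> x\<bar> \<le> \<tau> 0 + R" using \<tau>_add_le[of 0 x] \<tau>_nonneg[of x] by simp
  qed
  then show ?thesis unfolding lam_def by (rule ultrafilter_tendsto_Lim[OF ultra])
qed

lemma convex_\<tau>: "convex_on UNIV (\<lambda>h. \<tau> (v + h))"
proof (rule convex_onI)
  fix t :: real and x y :: 'a assume t: "0 < t" "t < 1"
  let ?z = "(1 - t) *\<^sub>R x + t *\<^sub>R y"
  have "(1 - t) * (\<tau> (v + ?z) + \<tau>' (v + ?z) (x - ?z)) \<le> (1 - t) * \<tau> (v + x)"
    using \<tau>_subgradient[of "v + ?z" "x - ?z"] t by (intro mult_left_mono) auto
  moreover have "t * (\<tau> (v + ?z) + \<tau>' (v + ?z) (y - ?z)) \<le> t * \<tau> (v + y)"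
    using \<tau>_subgradient[of "v + ?z" "y - ?z"] t by (intro mult_left_mono) auto
  moreover have "(1 - t) * \<tau>' (v + ?z) (x - ?z) + t * \<tau>' (v + ?z) (y - ?z) = 0"
  proof -
    have lin: "linear (\<tau>' (v + ?z))" using bounded_linear_\<tau>' by (rule bounded_linear.linear)
    have "(1 - t) * \<tau>' (v + ?z) (x - ?z) + t * \<tau>' (v + ?z) (y - ?z)
        = \<tau>' (v + ?z) ((1 - t) *\<^sub>R (x - ?z) + t *\<^sub>R (y - ?z))"
      by (simp only: linear_add[OF lin] linear_scale[OF lin] real_scaleR_def)
    also have "(1 - t) *\<^sub>R (x - ?z) + t *\<^sub>R (y - ?z) = 0" by (simp add: algebra_simps)
    finally show ?thesis using linear_0[OF lin] by simp
  qed
  ultimately show "\<tau> (v + ?z) \<le> (1 - t) * \<tau> (v + x) + t * \<tau> (v + y)"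
    by (simp add: algebra_simps)
qed simp

text \<open>The same \<open>d\<close> serves the norm and \<open>\<tau>\<close>: the estimate for \<open>\<tau>\<close> at \<open>v\<close> is the limit of those for the
  norm at \<open>v - x\<close>, which apply since \<open>\<parallel>v - x\<parallel> > c\<close> eventually.\<close>

lemma uniform_first_order_estimates:
  assumes "e > 0" "c > 0"
  shows "\<exists>d>0. (\<forall>v h::'a. c \<le> norm v \<longrightarrow> norm h \<le> d \<longrightarrow>
             norm (v + h) \<le> norm v + norming_functional v h + e * norm h) \<and>
           (\<forall>v h. c < \<tau> v \<longrightarrow> norm h \<le> d \<longrightarrow> \<tau> (v + h) \<le> \<tau> v + \<tau>' v h + e * norm h)"
proof -
  obtain d where d: "d > 0" "\<And>v h::'a. c \<le> norm v \<Longrightarrow> norm h \<le> d \<Longrightarrow>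
      norm (v + h) + norm (v - h) - 2 * norm v \<le> e * norm h"
    using uniformly_smooth_norm_second_difference[OF smooth assms] by blast
  have norm: "norm (v + h) \<le> norm v + norming_functional v h + e * norm h"
    if "c \<le> norm v" "norm h \<le> d" for v h :: 'a
    using d(2)[OF that] norming_functional_subgradient[OF smooth, of v "- h"]
      linear_neg[OF linear_norming_functional, of v h]
    by simp
  have "\<tau> (v + h) \<le> \<tau> v + \<tau>' v h + e * norm h" if "c < \<tau> v" "norm h \<le> d" for v h
  proof (rule tendsto_le[OF nonbot])
    show "((\<lambda>x. norm (v + h - x)) \<longlongrightarrow> \<tau> (v + h)) U" by (rule tendsto_\<tau>)
    show "((\<lambda>x. norm (v - x) + norming_functional (v - x) h + e * norm h)
        \<longlongrightarrow> \<tau> v + \<tau>' v h + e * norm h) U"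
      by (intro tendsto_intros tendsto_\<tau> tendsto_\<tau>')
    have "\<forall>\<^sub>F x in U. c < norm (v - x)" using order_tendstoD(1)[OF tendsto_\<tau> that(1)] .
    then show "\<forall>\<^sub>F x in U. norm (v + h - x) \<le> norm (v - x) + norming_functional (v - x) h + e * norm h"
      by eventually_elim (use norm[of "v - x" h for x] that(2) in \<open>simp add: algebra_simps\<close>)
  qed
  with d(1) norm show ?thesis by blast
qed

end

section \<open>Extending equilateral configurations\<close>

context weakly_null_ultrafilter
begin

text \<open>Besides the mutual distances, \<open>\<tau> (y i) = lam\<close> says that a generic point is at almost the right
  distance from all the \<open>y i\<close>. The vectors \<open>v\<close> make the distances to the \<open>y i\<close> independently
  adjustable, and being in the kernel of \<open>\<gamma>\<close> they do so without changing \<open>\<tau>\<close> at a generic point to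
  first order.\<close>

definition extendable_configuration :: "nat \<Rightarrow> (nat \<Rightarrow> 'a) \<Rightarrow> bool" where
  "extendable_configuration n y \<longleftrightarrow>
     (\<forall>i<n. \<forall>j<n. i \<noteq> j \<longrightarrow> norm (y i - y j) = lam) \<and>
     (\<forall>i<n. \<tau> (y i) = lam) \<and>
     (\<exists>v. (\<forall>i<n. \<forall>j<n. \<tau>' (y i) (v j) = (if i = j then 1 else 0)) \<and> (\<forall>j<n. \<gamma> (v j) = 0))"

text \<open>The new point is \<open>x + h\<close> with \<open>x\<close> generic and \<open>h\<close> a small solution of \<open>n + 1\<close> equations, the last
  of which keeps \<open>\<tau>\<close> at the level \<open>lam\<close>. The gap enters twice: it bounds \<open>\<tau>' x x\<close> from below, so that
  \<open>\<tau>\<close> can be adjusted by moving along \<open>x\<close>, and it gives \<open>\<tau>' z x > 0\<close> at the new point \<open>z\<close>, so that \<open>x\<close>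
  can serve as the new dual vector.\<close>

lemma extend_configuration:
  assumes gap: "\<tau> 0 < lam" and conf: "extendable_configuration n y"
  shows "\<exists>z. extendable_configuration (Suc n) (y(n := z))"
proof -
  obtain v where v_all: "\<forall>i<n. \<forall>j<n. \<tau>' (y i) (v j) = (if i = j then 1 else 0)" "\<forall>j<n. \<gamma> (v j) = 0"
    using conf unfolding extendable_configuration_def by (elim conjE exE)
  have equi: "norm (y i - y j) = lam" if "i < n" "j < n" "i \<noteq> j" for i j
    using conf that by (simp add: extendable_configuration_def)
  have \<tau>_y: "\<tau> (y i) = lam" if "i < n" for i
    using conf that by (simp add: extendable_configuration_def)
  have v: "\<tau>' (y i) (v j) = (if i = j then 1 else 0)" if "i < n" "j < n" for i j
    using v_all(1) that by simp
  have \<gamma>_v: "\<gamma> (v j) = 0" if "j < n" for j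
    using v_all(2) that by simp
  obtain R0 where R0: "\<forall>\<^sub>F x in U. norm x \<le> R0" using bounded by blast
  define R where "R = max R0 1"
  have R: "R > 0" "\<forall>\<^sub>F x in U. norm x \<le> R"
    using R0 by (auto simp: R_def elim: eventually_mono)
  have lam: "lam > 0" using gap \<tau>_nonneg[of 0] by linarith
  define A where "A = (lam - \<tau> 0) / 2"
  define V where "V = (\<Sum>j<n. norm (v j))"
  \<comment> \<open>A bound for the directions \<open>u j\<close> below, available before \<open>x\<close> is chosen.\<close>
  define C where "C = V + (R + R * V) / A"
  define e where "e = 1 / (8 * Suc n * C)"
  have A: "A > 0" using gap by (simp add: A_def)
  have V: "V \<ge> 0" by (simp add: V_def sum_nonneg)
  have RV: "(R + R * V) / A > 0" using R V A by (intro divide_pos_pos add_pos_nonneg) auto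
  have C: "C > 0" "V \<le> C" "(R + R * V) / A \<le> C" using V RV by (auto simp: C_def)
  have e: "e > 0" using C by (simp add: e_def)
  obtain d where "d > 0"
    and upper_norm: "\<And>w h::'a. lam / 2 \<le> norm w \<Longrightarrow> norm h \<le> d \<Longrightarrow>
        norm (w + h) \<le> norm w + norming_functional w h + e * norm h"
    and upper_\<tau>: "\<And>w h. lam / 2 < \<tau> w \<Longrightarrow> norm h \<le> d \<Longrightarrow> \<tau> (w + h) \<le> \<tau> w + \<tau>' w h + e * norm h"
    using uniform_first_order_estimates[OF e, of "lam / 2"] lam by auto
  define r where "r = min (d / 2) A"
  have r: "r > 0" "r \<le> d / 2" "r \<le> A" using A \<open>d > 0\<close> by (auto simp: r_def)
  define s where "s = r / (2 * Suc n * C)"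
  have s: "s > 0" using r C by (simp add: s_def)
  define \<beta> where "\<beta> = 1 / (4 * Suc n)"
  \<comment> \<open>Errors of size \<open>\<eta>\<close> in the single entries stay below \<open>\<beta>\<close> even when summed with the weights \<open>b j / a\<close> below.\<close>
  define \<eta> where "\<eta> = \<beta> / (1 + n * R / A)"
  have \<eta>1: "1 + n * R / A \<ge> 1" using R A by simp
  have \<eta>: "\<eta> > 0" "\<eta> \<le> \<beta>" "n * R * \<eta> / A \<le> \<beta>"
  proof -
    have \<beta>: "\<beta> > 0" by (simp add: \<beta>_def)
    then show "\<eta> > 0" using \<eta>1 unfolding \<eta>_def by (intro divide_pos_pos) auto
    have *: "\<eta> * (1 + n * R / A) = \<beta>" using \<eta>1 by (simp add: \<eta>_def)
    have "0 \<le> n * R * \<eta> / A" using \<open>\<eta> > 0\<close> R A by simp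
    moreover have "\<eta> + n * R * \<eta> / A = \<beta>" using * by (simp add: algebra_simps)
    ultimately show "\<eta> \<le> \<beta>" "n * R * \<eta> / A \<le> \<beta>" using \<open>\<eta> > 0\<close> by linarith+
  qed
  have close: "\<forall>\<^sub>F x in U. \<bar>f x - l\<bar> < \<delta>" if "(f \<longlongrightarrow> l) U" "\<delta> > 0" for f :: "'a \<Rightarrow> real" and l \<delta>
    using tendstoD[OF that] by (simp add: dist_real_def)
  have "\<forall>\<^sub>F x in U. \<forall>i\<in>{..<n}. \<forall>j\<in>{..<n}.
      \<bar>norming_functional (y i - x) (v j) - (if i = j then 1 else 0)\<bar> < \<eta>"
  proof (intro eventually_ball_finite ballI)
    fix i j assume "i \<in> {..<n}" "j \<in> {..<n}"
    then have "((\<lambda>x. norming_functional (y i - x) (v j)) \<longlongrightarrow> (if i = j then 1 else 0)) U"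
      using tendsto_\<tau>'[of "y i" "v j"] v[of i j] by simp
    then show "\<forall>\<^sub>F x in U. \<bar>norming_functional (y i - x) (v j) - (if i = j then 1 else 0)\<bar> < \<eta>"
      by (rule close) (rule \<eta>(1))
  qed auto
  moreover have "\<forall>\<^sub>F x in U. \<forall>j\<in>{..<n}. \<bar>\<tau>' x (v j) - 0\<bar> < \<eta>"
  proof (intro eventually_ball_finite ballI)
    fix j assume "j \<in> {..<n}"
    then have "((\<lambda>x. \<tau>' x (v j)) \<longlongrightarrow> 0) U"
      using tendsto_\<gamma>[of "v j"] \<gamma>_v[of j] by simp
    then show "\<forall>\<^sub>F x in U. \<bar>\<tau>' x (v j) - 0\<bar> < \<eta>" by (rule close) (rule \<eta>(1))
  qed auto
  moreover have "\<forall>\<^sub>F x in U. \<forall>i\<in>{..<n}. \<bar>norm (y i - x) - lam\<bar> < min s (lam / 2)"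
  proof (intro eventually_ball_finite ballI)
    fix i assume "i \<in> {..<n}"
    then have "((\<lambda>x. norm (y i - x)) \<longlongrightarrow> lam) U"
      using tendsto_\<tau>[of "y i"] \<tau>_y[of i] by simp
    then show "\<forall>\<^sub>F x in U. \<bar>norm (y i - x) - lam\<bar> < min s (lam / 2)"
      by (rule close) (use s lam in simp)
  qed auto
  moreover have "\<forall>\<^sub>F x in U. \<bar>\<tau> x - lam\<bar> < min (min s A) (lam / 2)"
    using s lam A by (intro close tendsto_lam) auto
  moreover have "\<forall>\<^sub>F x in U. \<forall>i\<in>{..<n}. \<tau>' (y i) x = 0"
    by (intro eventually_ball_finite ballI null bounded_linear_\<tau>') auto
  moreover have "\<forall>\<^sub>F x in U. \<gamma> x = 0" by (intro null bounded_linear_\<gamma>)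
  ultimately have "\<forall>\<^sub>F x in U. norm x \<le> R \<and>
      (\<forall>i\<in>{..<n}. \<forall>j\<in>{..<n}. \<bar>norming_functional (y i - x) (v j) - (if i = j then 1 else 0)\<bar> < \<eta>) \<and>
      (\<forall>j\<in>{..<n}. \<bar>\<tau>' x (v j) - 0\<bar> < \<eta>) \<and>
      (\<forall>i\<in>{..<n}. \<bar>norm (y i - x) - lam\<bar> < min s (lam / 2)) \<and>
      \<bar>\<tau> x - lam\<bar> < min (min s A) (lam / 2) \<and> (\<forall>i\<in>{..<n}. \<tau>' (y i) x = 0) \<and> \<gamma> x = 0"
    using R(2) by eventually_elim (intro conjI; assumption)
  from eventually_happens'[OF nonbot this] obtain x where x_R: "norm x \<le> R"
    and x: "\<forall>i\<in>{..<n}. \<forall>j\<in>{..<n}.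
        \<bar>norming_functional (y i - x) (v j) - (if i = j then 1 else 0)\<bar> < \<eta>"
      "\<forall>j\<in>{..<n}. \<bar>\<tau>' x (v j) - 0\<bar> < \<eta>"
      "\<forall>i\<in>{..<n}. \<bar>norm (y i - x) - lam\<bar> < min s (lam / 2)"
      "\<forall>i\<in>{..<n}. \<tau>' (y i) x = 0"
      "\<bar>\<tau> x - lam\<bar> < min (min s A) (lam / 2)"
    and \<gamma>_x: "\<gamma> x = 0"
    by (elim exE conjE)
  have x_nf: "\<bar>norming_functional (y i - x) (v j) - (if i = j then 1 else 0)\<bar> < \<eta>"
    if "i < n" "j < n" for i j using x(1) that by blast
  have x_\<tau>': "\<bar>\<tau>' x (v j)\<bar> < \<eta>" if "j < n" for j using x(2) that by simp
  have x_norm: "\<bar>norm (y i - x) - lam\<bar> < s" "\<bar>norm (y i - x) - lam\<bar> < lam / 2" if "i < n" for i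
    using x(3) that by auto
  have x_\<tau>: "\<bar>\<tau> x - lam\<bar> < s" "\<bar>\<tau> x - lam\<bar> < A" "\<bar>\<tau> x - lam\<bar> < lam / 2"
    using x(5) by auto
  have x_null: "\<tau>' (y i) x = 0" if "i < n" for i using x(4) that by blast
  have lin_\<tau>': "linear (\<tau>' w)" for w using bounded_linear_\<tau>' by (rule bounded_linear.linear)
  have lin_\<gamma>: "linear \<gamma>" using bounded_linear_\<gamma> by (rule bounded_linear.linear)
  define a where "a = \<tau>' x x"
  have a: "a \<ge> A"
  proof -
    have "\<tau> x - \<tau>' x x \<le> \<tau> 0" using \<tau>_subgradient[of x "- x"] linear_neg[OF lin_\<tau>'] by simp
    moreover have "lam - \<tau> x < A" using x_\<tau>(2) by (simp add: abs_less_iff)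
    moreover have "lam - \<tau> 0 = A + A" by (simp add: A_def)
    ultimately show ?thesis unfolding a_def by linarith
  qed
  \<comment> \<open>The coefficients \<open>b j\<close> compensate the effect on \<open>\<parallel>y i - x\<parallel>\<close> of moving along \<open>x\<close>, so that \<open>w\<close> changes
    only \<open>\<tau>\<close> to first order.\<close>
  define b where "b j = - norming_functional (y j - x) x" for j
  have b: "\<bar>b j\<bar> \<le> R" for j
    using norming_functional_le[of "y j - x" x] x_R by (simp add: b_def)
  define w where "w = x + (\<Sum>j<n. b j *\<^sub>R v j)"
  define u where "u j = (if j < n then - v j else w /\<^sub>R a)" for j
  define F where "F i h = (if i < n then norm (y i - x - h) else \<tau> (x + h))" for i h
  define L where "L i h = (if i < n then - norming_functional (y i - x) h else \<tau>' x h)" for i h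
  have a0: "a > 0" using a A by linarith
  have b_sum: "\<bar>\<Sum>j<n. b j * t j\<bar> / a \<le> \<beta>" if "\<And>j. j < n \<Longrightarrow> \<bar>t j\<bar> \<le> \<eta>" for t
  proof -
    have "\<bar>\<Sum>j<n. b j * t j\<bar> \<le> (\<Sum>j<n. R * \<eta>)"
    proof (rule order_trans[OF sum_abs sum_mono])
      fix j assume "j \<in> {..<n}"
      then show "\<bar>b j * t j\<bar> \<le> R * \<eta>"
        unfolding abs_mult using that[of j] b[of j] R(1) by (intro mult_mono) auto
    qed
    then have "\<bar>\<Sum>j<n. b j * t j\<bar> / a \<le> (n * R * \<eta>) / A"
      using a A \<eta> R by (intro frac_le) auto
    then show ?thesis using \<eta>(3) by linarith
  qed
  have lin_L: "linear (L i)" for i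
  proof (cases "i < n")
    case True
    then have "L i = (\<lambda>h. - norming_functional (y i - x) h)" by (auto simp: L_def)
    then show ?thesis using linear_compose_neg[OF linear_norming_functional] by simp
  next
    case False
    then have "L i = \<tau>' x" by (auto simp: L_def)
    then show ?thesis using lin_\<tau>' by simp
  qed
  have "\<exists>h. norm h \<le> r \<and> (\<forall>i<Suc n. F i h = lam)"
  proof (rule near_biorthogonal_system_solvable)
    show "linear (L i)" for i by (rule lin_L)
    show "norm (u j) \<le> C" for j
    proof (cases "j < n")
      case True
      then have "norm (v j) \<le> V" unfolding V_def by (intro member_le_sum) auto
      then show ?thesis using True C by (simp add: u_def)
    next
      case False
      have "norm (\<Sum>j<n. b j *\<^sub>R v j) \<le> (\<Sum>j<n. R * norm (v j))"
        by (rule sum_norm_le) (simp add: b mult_right_mono)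
      then have "norm w \<le> R + R * V"
        unfolding w_def V_def sum_distrib_left[symmetric] using x_R norm_triangle_mono by blast
      then have "norm w / a \<le> (R + R * V) / A"
        using a A R V by (intro frac_le) auto
      then show ?thesis using False C a0 by (simp add: u_def divide_inverse mult.commute)
    qed
    show "\<bar>L i (u j) - (if i = j then 1 else 0)\<bar> \<le> 1 / (4 * real (Suc n))"
      if ij: "i < Suc n" "j < Suc n" for i j
    proof -
      consider "i < n" "j < n" | "i < n" "j = n" | "i = n" "j < n" | "i = n" "j = n" using ij by linarith
      then have "\<bar>L i (u j) - (if i = j then 1 else 0)\<bar> \<le> \<beta>"
      proof cases
        case 1
        then show ?thesis using x_nf[of i j] \<eta>(2) by (simp add: L_def u_def linear_neg[OF linear_norming_functional])
      next
        case 2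
        have "L i w = b i + (\<Sum>j<n. b j * (- norming_functional (y i - x) (v j)))"
          using 2 by (simp add: L_def w_def linear_add[OF linear_norming_functional] linear_sum[OF linear_norming_functional]
              linear_scale[OF linear_norming_functional] sum_negf) (simp add: b_def)
        also have "b i = (\<Sum>j<n. b j * (if i = j then 1 else 0))"
          using 2 by (simp add: if_distrib sum.delta cong: if_cong)
        finally have "L i w = (\<Sum>j<n. b j * ((if i = j then 1 else 0) - norming_functional (y i - x) (v j)))"
          by (simp add: right_diff_distrib sum_subtractf sum_negf)
        then have "\<bar>L i w\<bar> / a \<le> \<beta>"
          using b_sum[of "\<lambda>j. (if i = j then 1 else 0) - norming_functional (y i - x) (v j)"]
            x_nf[OF 2(1)] by (simp only: abs_minus_commute less_imp_le)
        then show ?thesis using 2 a0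
          by (simp add: u_def linear_scale[OF lin_L] abs_mult divide_inverse mult.commute)
      next
        case 3
        then show ?thesis using x_\<tau>'[of j] \<eta>(2) by (simp add: L_def u_def linear_neg[OF lin_\<tau>'])
      next
        case 4
        have "L n w = a + (\<Sum>j<n. b j * \<tau>' x (v j))"
          by (simp add: L_def w_def linear_add[OF lin_\<tau>'] linear_sum[OF lin_\<tau>'] linear_scale[OF lin_\<tau>'] a_def)
        then have "L n (u n) - 1 = (\<Sum>j<n. b j * \<tau>' x (v j)) / a"
          using a0 by (simp add: u_def linear_scale[OF lin_L] field_simps)
        then have "\<bar>L n (u n) - 1\<bar> \<le> \<beta>"
          using b_sum[of "\<lambda>j. \<tau>' x (v j)"] x_\<tau>' a0 by (simp add: less_imp_le)
        then show ?thesis using 4 by simp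
      qed
      then show ?thesis by (simp add: \<beta>_def)
    qed
    show "\<bar>F i h - F i k - L i (h - k)\<bar> \<le> norm (h - k) / (4 * real (Suc n) * C)"
      if i: "i < Suc n" and hk: "norm h \<le> r" "norm k \<le> r" for i h k
    proof -
      have "\<bar>F i h - F i k - L i (h - k)\<bar> \<le> 2 * e * norm (h - k)"
      proof (cases "i < n")
        case True
        have big: "lam / 2 \<le> norm (y i - x)" using x_norm(2)[OF True] by linarith
        have [simp]: "norming_functional (y i - x) (- h) = - norming_functional (y i - x) h" for h
          by (rule linear_neg[OF linear_norming_functional])
        show ?thesis
        proof (rule strict_derivative_of_convex[OF _ lin_L _ _ \<open>d > 0\<close> e])
          show "convex_on UNIV (F i)"
          proof -
            have "F i = (\<lambda>h. norm (y i - x - h))" using True by (auto simp: F_def)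
            then show ?thesis using convex_norm_minus[of "y i - x"] by simp
          qed
          show "F i 0 + L i h \<le> F i h" for h
            using norming_functional_subgradient[OF smooth, of "y i - x" "- h"] True by (simp add: F_def L_def)
          show "F i h \<le> F i 0 + L i h + e * norm h" if "norm h \<le> d" for h
            using upper_norm[OF big, of "- h"] that True by (simp add: F_def L_def)
        qed (use hk r in auto)
      next
        case False
        have big: "lam / 2 < \<tau> x" using x_\<tau>(3) by linarith
        show ?thesis
        proof (rule strict_derivative_of_convex[OF _ lin_L _ _ \<open>d > 0\<close> e])
          show "convex_on UNIV (F i)"
          proof -
            have "F i = (\<lambda>h. \<tau> (x + h))" using False by (auto simp: F_def)
            then show ?thesis using convex_\<tau>[of x] by simp
          qed
          show "F i 0 + L i h \<le> F i h" for h
            using \<tau>_subgradient[of x h] False by (simp add: F_def L_def)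
          show "F i h \<le> F i 0 + L i h + e * norm h" if "norm h \<le> d" for h
            using upper_\<tau>[OF big that] False by (simp add: F_def L_def)
        qed (use hk r in auto)
      qed
      also have "\<dots> = norm (h - k) / (4 * real (Suc n) * C)"
        using C(1) by (simp add: e_def divide_simps)
      finally show ?thesis .
    qed
    show "\<bar>F i 0 - lam\<bar> \<le> r / (2 * real (Suc n) * C)" if "i < Suc n" for i
    proof -
      have "\<bar>F i 0 - lam\<bar> \<le> s" using x_norm(1)[of i] x_\<tau>(1) by (auto simp: F_def)
      then show ?thesis by (simp only: s_def)
    qed
  qed (use C r in auto)
  then obtain h where h: "norm h \<le> r" and F_h: "\<And>i. i < Suc n \<Longrightarrow> F i h = lam" by blast
  define z where "z = x + h"
  have z_norm: "norm (y i - z) = lam" if "i < n" for i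
    using F_h[of i] that by (simp add: F_def z_def algebra_simps)
  have z_\<tau>: "\<tau> z = lam" using F_h[of n] by (simp add: F_def z_def)
  have z_pos: "\<tau>' z x > 0"
  proof -
    have "\<tau> z - \<tau>' z x \<le> \<tau> h" using \<tau>_subgradient[of z "- x"] linear_neg[OF lin_\<tau>'] by (simp add: z_def)
    also have "\<dots> \<le> \<tau> 0 + norm h" using \<tau>_add_le[of 0 h] by simp
    finally show ?thesis using h r A z_\<tau> by (simp add: A_def)
  qed
  \<comment> \<open>Gram-Schmidt: subtracting multiples of \<open>x\<close> kills \<open>\<tau>' z\<close> on the old dual vectors and leaves \<open>\<tau>' (y i)\<close>
    and \<open>\<gamma>\<close> unchanged, as these vanish on \<open>x\<close>.\<close>
  define v' where "v' j = (if j < n then v j - (\<tau>' z (v j) / \<tau>' z x) *\<^sub>R x else x /\<^sub>R \<tau>' z x)" for j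
  have "extendable_configuration (Suc n) (y(n := z))"
    unfolding extendable_configuration_def
  proof (intro conjI exI[of _ v'] allI impI)
    show "norm ((y(n := z)) i - (y(n := z)) j) = lam" if "i < Suc n" "j < Suc n" "i \<noteq> j" for i j
      using that equi z_norm by (auto simp: norm_minus_commute less_Suc_eq)
    show "\<tau> ((y(n := z)) i) = lam" if "i < Suc n" for i
      using that \<tau>_y z_\<tau> by (auto simp: less_Suc_eq)
    show "\<tau>' ((y(n := z)) i) (v' j) = (if i = j then 1 else 0)" if "i < Suc n" "j < Suc n" for i j
      using that z_pos x_null v
      by (auto simp: v'_def less_Suc_eq linear_diff[OF lin_\<tau>'] linear_scale[OF lin_\<tau>'])
    show "\<gamma> (v' j) = 0" if "j < Suc n" for j
      using that \<gamma>_x \<gamma>_v by (auto simp: v'_def less_Suc_eq linear_diff[OF lin_\<gamma>] linear_scale[OF lin_\<gamma>])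
  qed
  then show ?thesis ..
qed

lemma equilateral_sequence_if_gap:
  assumes gap: "\<tau> 0 < lam"
  shows "\<exists>x :: nat \<Rightarrow> 'a. \<forall>i j. i \<noteq> j \<longrightarrow> norm (x i - x j) = lam"
proof -
  have "\<exists>y. \<forall>n. extendable_configuration n (y n) \<and> (\<exists>z. y (Suc n) = (y n)(n := z))"
  proof (rule dependent_nat_choice)
    show "\<exists>y. extendable_configuration 0 y" by (simp add: extendable_configuration_def)
    show "\<exists>y'. extendable_configuration (Suc n) y' \<and> (\<exists>z. y' = y(n := z))"
      if "extendable_configuration n y" for y n
      using extend_configuration[OF gap that] by blast
  qed
  then obtain y where conf: "\<And>n. extendable_configuration n (y n)"
    and step: "\<And>n. \<exists>z. y (Suc n) = (y n)(n := z)" by blast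
  have stable: "y m i = y (Suc i) i" if "i < m" for i m
    using that
  proof (induction m)
    case (Suc m)
    then show ?case using step[of m] by (cases "i = m") auto
  qed simp
  have "norm (y (Suc i) i - y (Suc j) j) = lam" if "i \<noteq> j" for i j
  proof -
    let ?m = "Suc (max i j)"
    have "norm (y ?m i - y ?m j) = lam"
      using conf[of ?m] that by (auto simp: extendable_configuration_def)
    then show ?thesis using stable[of i ?m] stable[of j ?m] by simp
  qed
  then show ?thesis by (intro exI[of _ "\<lambda>i. y (Suc i) i"]) blast
qed

end

section \<open>Opening a gap with differences\<close>

text \<open>The law of \<open>x - y\<close> for independent \<open>x\<close> and \<open>y\<close>, where \<open>y\<close> is chosen far out depending on \<open>x\<close>.
  The product filter would not do, because it need not be an ultrafilter.\<close>

definition difference_filter :: "'a::ab_group_add filter \<Rightarrow> 'a filter" where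
  "difference_filter U = Abs_filter (\<lambda>P. \<forall>\<^sub>F x in U. \<forall>\<^sub>F y in U. P (x - y))"

lemma eventually_difference_filter:
  "eventually P (difference_filter U) \<longleftrightarrow> (\<forall>\<^sub>F x in U. \<forall>\<^sub>F y in U. P (x - y))"
  unfolding difference_filter_def
proof (rule eventually_Abs_filter, rule is_filter.intro)
  fix P Q :: "'a \<Rightarrow> bool"
  assume PQ: "\<forall>\<^sub>F x in U. \<forall>\<^sub>F y in U. P (x - y)" "\<forall>\<^sub>F x in U. \<forall>\<^sub>F y in U. Q (x - y)"
  from PQ show "\<forall>\<^sub>F x in U. \<forall>\<^sub>F y in U. P (x - y) \<and> Q (x - y)"
    by eventually_elim (rule eventually_conj)
next
  fix P Q :: "'a \<Rightarrow> bool"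
  assume imp: "\<forall>x. P x \<longrightarrow> Q x" and "\<forall>\<^sub>F x in U. \<forall>\<^sub>F y in U. P (x - y)"
  from this(2) show "\<forall>\<^sub>F x in U. \<forall>\<^sub>F y in U. Q (x - y)"
    by eventually_elim (use imp in \<open>auto elim: eventually_mono\<close>)
qed simp

context weakly_null_ultrafilter
begin

lemma eventually_or_not: "eventually P U \<or> (\<forall>\<^sub>F x in U. \<not> P x)"
  using ultra by (rule ultrafilter_dichotomy)

lemma difference_filter_weakly_null: "weakly_null_ultrafilter (difference_filter U)"
proof
  have "difference_filter U \<noteq> bot"
    unfolding trivial_limit_def eventually_difference_filter by (simp add: eventually_const_iff)
  moreover have "(\<forall>\<^sub>F z in difference_filter U. P z) \<or> (\<forall>\<^sub>F z in difference_filter U. \<not> P z)" for P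
  proof (cases "\<forall>\<^sub>F x in U. \<forall>\<^sub>F y in U. P (x - y)")
    case False
    then have "\<forall>\<^sub>F x in U. \<not> (\<forall>\<^sub>F y in U. P (x - y))" using eventually_or_not by blast
    then have "\<forall>\<^sub>F x in U. \<forall>\<^sub>F y in U. \<not> P (x - y)"
      by eventually_elim (use eventually_or_not in blast)
    then show ?thesis by (simp add: eventually_difference_filter)
  qed (simp add: eventually_difference_filter)
  ultimately show "ultrafilter (difference_filter U)"
    unfolding ultrafilter_def by blast
next
  obtain R where R: "\<forall>\<^sub>F x in U. norm x \<le> R" using bounded by blast
  have "\<forall>\<^sub>F x in U. \<forall>\<^sub>F y in U. norm (x - y) \<le> R + R"
    using R
  proof eventually_elim
    fix x :: 'a assume x: "norm x \<le> R"
    show "\<forall>\<^sub>F y in U. norm (x - y) \<le> R + R"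
      using R
    proof eventually_elim
      fix y :: 'a assume "norm y \<le> R"
      then show "norm (x - y) \<le> R + R" using x norm_triangle_ineq4[of x y] by linarith
    qed
  qed
  then show "\<exists>R. \<forall>\<^sub>F z in difference_filter U. norm z \<le> R"
    by (auto simp: eventually_difference_filter)
next
  fix g :: "'a \<Rightarrow> real" assume g: "bounded_linear g"
  have "\<forall>\<^sub>F x in U. \<forall>\<^sub>F y in U. g (x - y) = 0"
    using null[OF g]
  proof eventually_elim
    fix x assume x: "g x = 0"
    show "\<forall>\<^sub>F y in U. g (x - y) = 0"
      using null[OF g] by eventually_elim (simp add: x linear_diff[OF bounded_linear.linear[OF g]])
  qed
  then show "\<forall>\<^sub>F z in difference_filter U. g z = 0"
    by (simp add: eventually_difference_filter)
qed (rule smooth)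

text \<open>Otherwise both \<open>x + y\<close> and \<open>x - y\<close> have norm about \<open>1\<close> for typical unit vectors \<open>x\<close>, \<open>y\<close>. As
  \<open>x\<close> and \<open>y\<close> are almost annihilated by each other's norming functionals, the vectors
  \<open>(x + y) \<plusminus> t *\<^sub>R (x - y)\<close>, in which \<open>x\<close> or \<open>y\<close> has the coefficient \<open>1 + t\<close>, have norm at least about
  \<open>1 + t\<close>. So the second difference of the norm at \<open>x + y\<close> is about \<open>2 * t\<close>, too much for
  a smooth norm.\<close>

lemma iterated_sum_exceeds_one:
  assumes unit: "\<forall>\<^sub>F x in U. norm x = 1" and lam: "lam \<le> 1"
  shows "\<exists>\<eta>>0. \<forall>\<^sub>F x in U. \<forall>\<^sub>F y in U. 1 + \<eta> \<le> norm (x + y)"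
proof (rule ccontr)
  assume contra: "\<not> ?thesis"
  have small: "\<forall>\<^sub>F x in U. \<forall>\<^sub>F y in U. norm (x + y) < 1 + \<epsilon>" if "\<epsilon> > 0" for \<epsilon>
  proof -
    have "\<not> (\<forall>\<^sub>F x in U. \<forall>\<^sub>F y in U. 1 + \<epsilon> \<le> norm (x + y))" using contra that by blast
    then have "\<forall>\<^sub>F x in U. \<not> (\<forall>\<^sub>F y in U. 1 + \<epsilon> \<le> norm (x + y))" using eventually_or_not by blast
    then show ?thesis
    proof eventually_elim
      fix x assume "\<not> (\<forall>\<^sub>F y in U. 1 + \<epsilon> \<le> norm (x + y))"
      then have "\<forall>\<^sub>F y in U. \<not> 1 + \<epsilon> \<le> norm (x + y)" using eventually_or_not by blast
      then show "\<forall>\<^sub>F y in U. norm (x + y) < 1 + \<epsilon>" by eventually_elim simp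
    qed
  qed
  obtain d where d: "d > 0" "\<And>v h::'a. 1 \<le> norm v \<Longrightarrow> norm h \<le> d \<Longrightarrow>
      norm (v + h) + norm (v - h) - 2 * norm v \<le> 1/2 * norm h"
    using uniformly_smooth_norm_second_difference[OF smooth, of "1/2" 1] by auto
  define t where "t = min (d / 2) (1 / 2)"
  define \<epsilon> where "\<epsilon> = t / 6"
  have t: "0 < t" "t \<le> 1/2" "2 * t \<le> d" using d(1) by (auto simp: t_def)
  have \<epsilon>: "0 < \<epsilon>" "\<epsilon> \<le> 1" using t by (auto simp: \<epsilon>_def)
  have "\<forall>\<^sub>F x in U. \<tau> x < 1 + \<epsilon>"
    using order_tendstoD(2)[OF tendsto_lam, of "1 + \<epsilon>"] lam \<epsilon> by simp
  with unit small[OF \<epsilon>(1)] null[OF bounded_linear_\<tau>'[of 0]]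
  have "\<forall>\<^sub>F x in U. norm x = 1 \<and> (\<forall>\<^sub>F y in U. norm (x + y) < 1 + \<epsilon>) \<and> \<tau>' 0 x = 0 \<and> \<tau> x < 1 + \<epsilon>"
    by eventually_elim (intro conjI)
  from eventually_happens'[OF nonbot this] obtain x where x: "norm x = 1" "\<tau>' 0 x = 0" "\<tau> x < 1 + \<epsilon>"
    and x_plus: "\<forall>\<^sub>F y in U. norm (x + y) < 1 + \<epsilon>" by blast
  have x_minus: "\<forall>\<^sub>F y in U. norm (x - y) < 1 + \<epsilon>"
    using order_tendstoD(2)[OF tendsto_\<tau> x(3)] .
  have x_nf: "\<forall>\<^sub>F y in U. norming_functional (0 - y) x < \<epsilon>"
    using order_tendstoD(2)[OF tendsto_\<tau>'[of 0 x], of \<epsilon>] x(2) \<epsilon>(1) by simp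
  have "\<forall>\<^sub>F y in U. norm y = 1 \<and> norm (x + y) < 1 + \<epsilon> \<and> norm (x - y) < 1 + \<epsilon>
      \<and> norming_functional (0 - y) x < \<epsilon> \<and> norming_functional x y = 0"
    using unit x_plus x_minus x_nf null[OF bounded_linear_norming_functional[OF smooth, of x]]
    by eventually_elim (intro conjI)
  from eventually_happens'[OF nonbot this] obtain y where y: "norm y = 1" "norm (x + y) < 1 + \<epsilon>"
      "norm (x - y) < 1 + \<epsilon>" "norming_functional (- y) x < \<epsilon>" "norming_functional x y = 0"
    by auto
  have p: "1 \<le> norm (x + y)"
    using norming_functional_subgradient[OF smooth, of x y] x y by simp
  have "norm (t *\<^sub>R (x - y)) \<le> t * (1 + \<epsilon>)" using y(3) t by simp
  also have "\<dots> \<le> t * 2" using t \<epsilon> by simp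
  finally have tq: "norm (t *\<^sub>R (x - y)) \<le> t * 2" .
  then have "norm (t *\<^sub>R (x - y)) \<le> d" using t(3) by linarith
  note upper = d(2)[OF p this]
  have plus: "1 + t \<le> norm ((x + y) + t *\<^sub>R (x - y))"
  proof -
    define s where "s = (1 - t) / (1 + t)"
    have s: "(1 + t) * s = 1 - t" using t by (simp add: s_def)
    have "(x + y) + t *\<^sub>R (x - y) = (1 + t) *\<^sub>R x + (1 - t) *\<^sub>R y"
      by (simp add: algebra_simps)
    also have "\<dots> = (1 + t) *\<^sub>R (x + s *\<^sub>R y)" using s by (simp add: scaleR_add_right)
    finally have "(x + y) + t *\<^sub>R (x - y) = (1 + t) *\<^sub>R (x + s *\<^sub>R y)" .
    moreover have "1 \<le> norm (x + s *\<^sub>R y)"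
      using norming_functional_subgradient[OF smooth, of x "s *\<^sub>R y"] x y
      by (simp add: linear_scale[OF linear_norming_functional])
    ultimately show ?thesis using t by simp
  qed
  have minus: "1 + t - \<epsilon> \<le> norm ((x + y) - t *\<^sub>R (x - y))"
  proof -
    define s where "s = (1 - t) / (1 + t)"
    have s: "0 \<le> s" "(1 + t) * s = 1 - t" using t by (auto simp: s_def)
    have "(x + y) - t *\<^sub>R (x - y) = (1 - t) *\<^sub>R x + (1 + t) *\<^sub>R y"
      by (simp add: algebra_simps)
    also have "\<dots> = (1 + t) *\<^sub>R (- (- y + (- s) *\<^sub>R x))"
      using s(2) by (simp add: scaleR_add_right)
    finally have eq: "(x + y) - t *\<^sub>R (x - y) = (1 + t) *\<^sub>R (- (- y + (- s) *\<^sub>R x))" .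
    have "1 - s * norming_functional (- y) x \<le> norm (- y + (- s) *\<^sub>R x)"
      using norming_functional_subgradient[OF smooth, of "- y" "(- s) *\<^sub>R x"] y(1)
      by (simp only: linear_scale[OF linear_norming_functional] norm_minus_cancel real_scaleR_def)
    then have "(1 + t) * (1 - s * norming_functional (- y) x) \<le> norm ((x + y) - t *\<^sub>R (x - y))"
      unfolding eq norm_scaleR norm_minus_cancel using t by simp
    moreover have "(1 + t) * (1 - s * norming_functional (- y) x) = 1 + t - (1 - t) * norming_functional (- y) x"
      unfolding s(2)[symmetric] by (simp add: algebra_simps)
    moreover have "(1 - t) * norming_functional (- y) x \<le> \<epsilon>"
    proof -
      have "(1 - t) * norming_functional (- y) x \<le> (1 - t) * \<epsilon>"
        using y(4) t by (intro mult_left_mono) auto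
      also have "\<dots> \<le> 1 * \<epsilon>" using t \<epsilon> by (intro mult_right_mono) auto
      finally show ?thesis by simp
    qed
    ultimately show ?thesis by linarith
  qed
  have "6 * \<epsilon> = t" by (simp add: \<epsilon>_def)
  then show False using upper plus minus y(2) tq t(1) by linarith
qed

text \<open>Here \<open>\<tau> 0\<close> for differences is \<open>lim \<parallel>x - y\<parallel> \<le> 1\<close>, while \<open>(x1 - x2) - (x3 - x4)\<close> dominates
  \<open>x2 + x3\<close> in norm: the last vector \<open>x4\<close> is annihilated by the norming functional of the rest, and the
  first vector \<open>x1\<close> by the limit \<open>k\<close> of the norming functionals of \<open>- x2 - x3\<close>.\<close>

lemma difference_filter_has_gap:
  assumes unit: "\<forall>\<^sub>F x in U. norm x = 1" and lam: "lam \<le> 1"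
  shows "weakly_null_ultrafilter.\<tau> (difference_filter U) 0
       < weakly_null_ultrafilter.lam (difference_filter U)"
proof -
  interpret D: weakly_null_ultrafilter "difference_filter U"
    by (rule difference_filter_weakly_null)
  obtain \<eta> where \<eta>: "\<eta> > 0" "\<forall>\<^sub>F x in U. \<forall>\<^sub>F y in U. 1 + \<eta> \<le> norm (x + y)"
    using iterated_sum_exceeds_one[OF assms] by blast
  have "D.\<tau> 0 \<le> 1 + \<eta> / 3"
  proof (rule tendsto_upperbound[OF D.tendsto_\<tau> _ D.nonbot])
    have "\<forall>\<^sub>F x in U. \<tau> x < 1 + \<eta> / 3"
      using order_tendstoD(2)[OF tendsto_lam, of "1 + \<eta> / 3"] lam \<eta> by simp
    then have "\<forall>\<^sub>F x in U. \<forall>\<^sub>F y in U. norm (x - y) < 1 + \<eta> / 3"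
      by eventually_elim (rule order_tendstoD(2)[OF tendsto_\<tau>])
    then show "\<forall>\<^sub>F z in difference_filter U. norm (0 - z) \<le> 1 + \<eta> / 3"
      unfolding eventually_difference_filter
      by eventually_elim (auto elim: eventually_mono simp: norm_minus_commute)
  qed
  moreover have "1 + \<eta> / 2 \<le> D.lam"
  proof (rule tendsto_lowerbound[OF D.tendsto_lam _ D.nonbot])
    define k where "k v = Lim U (\<lambda>x. \<tau>' (- x) v)" for v
    have k: "bounded_linear k"
      unfolding k_def by (intro bounded_linear_Lim ultra bounded_linear_\<tau>' \<tau>'_le)
    have k_lim: "((\<lambda>x. \<tau>' (- x) v) \<longlongrightarrow> k v) U" for v
      unfolding k_def by (rule ultrafilter_tendsto_Lim[OF ultra, of _ "norm v"]) (simp add: \<tau>'_le)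
    have "\<forall>\<^sub>F x1 in U. \<forall>\<^sub>F x2 in U. 1 + \<eta> / 2 \<le> D.\<tau> (x1 - x2)"
      using null[OF k]
    proof eventually_elim
      fix x1 assume "k x1 = 0"
      then have "\<forall>\<^sub>F x2 in U. - (\<eta> / 2) < \<tau>' (- x2) x1"
        using order_tendstoD(1)[OF k_lim[of x1], of "- (\<eta> / 2)"] \<eta>(1) by simp
      with \<eta>(2) show "\<forall>\<^sub>F x2 in U. 1 + \<eta> / 2 \<le> D.\<tau> (x1 - x2)"
      proof eventually_elim
        fix x2 assume x2: "\<forall>\<^sub>F x3 in U. 1 + \<eta> \<le> norm (x2 + x3)" "- (\<eta> / 2) < \<tau>' (- x2) x1"
        have "\<forall>\<^sub>F x3 in U. - (\<eta> / 2) < norming_functional (- x2 - x3) x1"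
          using order_tendstoD(1)[OF tendsto_\<tau>' x2(2)] .
        with x2(1) have "\<forall>\<^sub>F x3 in U. \<forall>\<^sub>F x4 in U. 1 + \<eta> / 2 \<le> norm (x1 - x2 - (x3 - x4))"
        proof eventually_elim
          fix x3 assume x3: "1 + \<eta> \<le> norm (x2 + x3)" "- (\<eta> / 2) < norming_functional (- x2 - x3) x1"
          have "norm (- x2 - x3) + norming_functional (- x2 - x3) x1 \<le> norm (- x2 - x3 + x1)"
            by (rule norming_functional_subgradient[OF smooth])
          moreover have "norm (- x2 - x3) = norm (x2 + x3)"
            by (metis norm_minus_cancel minus_add_distrib diff_conv_add_uminus)
          ultimately have *: "1 + \<eta> / 2 \<le> norm (- x2 - x3 + x1)" using x3 by linarith
          show "\<forall>\<^sub>F x4 in U. 1 + \<eta> / 2 \<le> norm (x1 - x2 - (x3 - x4))"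
            using null[OF bounded_linear_norming_functional[OF smooth, of "- x2 - x3 + x1"]]
          proof eventually_elim
            fix x4 assume "norming_functional (- x2 - x3 + x1) x4 = 0"
            then have "norm (- x2 - x3 + x1) \<le> norm (- x2 - x3 + x1 + x4)"
              using norming_functional_subgradient[OF smooth, of "- x2 - x3 + x1" x4] by simp
            also have "- x2 - x3 + x1 + x4 = x1 - x2 - (x3 - x4)" by (simp add: algebra_simps)
            finally show "1 + \<eta> / 2 \<le> norm (x1 - x2 - (x3 - x4))" using * by linarith
          qed
        qed
        then have "\<forall>\<^sub>F z in difference_filter U. 1 + \<eta> / 2 \<le> norm (x1 - x2 - z)"
          by (simp add: eventually_difference_filter)
        then show "1 + \<eta> / 2 \<le> D.\<tau> (x1 - x2)"
          by (rule tendsto_lowerbound[OF D.tendsto_\<tau> _ D.nonbot])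
      qed
    qed
    then show "\<forall>\<^sub>F z in difference_filter U. 1 + \<eta> / 2 \<le> D.\<tau> z"
      by (simp add: eventually_difference_filter)
  qed
  ultimately show ?thesis using \<eta>(1) by linarith
qed

end

section \<open>Infinite equilateral sets\<close>

theorem theorem4p2:
  assumes "infinite_dimensional TYPE('a::banach)"
    and "uniformly_smooth TYPE('a)"
  shows "\<exists>(x :: nat \<Rightarrow> 'a) (l :: real). l > 0 \<and> (\<forall>i j. i \<noteq> j \<longrightarrow> norm (x i - x j) = l)"
proof -
  obtain U :: "'a filter" where U: "ultrafilter U" "\<forall>\<^sub>F x in U. norm x = 1"
    "\<And>g :: 'a \<Rightarrow> real. bounded_linear g \<Longrightarrow> \<forall>\<^sub>F x in U. g x = 0"
    using weakly_null_ultrafilter_exists[OF assms(1)] by blast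
  interpret weakly_null_ultrafilter U
  proof
    show "\<exists>R. \<forall>\<^sub>F x in U. norm x \<le> R" using U(2) by (intro exI[of _ 1]) (auto elim: eventually_mono)
  qed (use assms(2) U in auto)
  have \<tau>0: "\<tau> 0 \<le> 1"
    using U(2) by (intro tendsto_upperbound[OF tendsto_\<tau> _ nonbot]) (auto elim: eventually_mono)
  obtain V :: "'a filter" where V: "weakly_null_ultrafilter V"
    "weakly_null_ultrafilter.\<tau> V 0 < weakly_null_ultrafilter.lam V"
  proof (cases "lam \<le> 1")
    case True
    show ?thesis
      by (rule that[OF difference_filter_weakly_null difference_filter_has_gap[OF U(2) True]])
  next
    case False
    show ?thesis
      by (rule that[OF weakly_null_ultrafilter_axioms]) (use False \<tau>0 in linarith)
  qed
  interpret V: weakly_null_ultrafilter V by (rule V(1))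
  have "V.lam > 0" using V.\<tau>_nonneg[of 0] V(2) by linarith
  then show ?thesis using V.equilateral_sequence_if_gap[OF V(2)] by blast
qed

end
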